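(* Let $\mu_0,\mu_1\in\mathcal{P}(\mathbb{R}^2)$ be measures with compact support and finite interaction energy, that is, $\int_{\mathbb{R}^2}(V*\mu_i)\,d\mu_i<+\infty$ for $i=0,1$. Then $$\int_{\mathbb{R}^2} V*(\mu_1-\mu_0)\,d(\mu_1-\mu_0)\ \geq\ 0,$$ and the integral above is zero if and only if $\mu_0=\mu_1$.
   Context: $\mathcal{P}(\mathbb{R}^2)$ denotes the class of all positive Borel measures on $\mathbb{R}^2$ with unit mass. The interaction potential $V:\mathbb{R}^2\to(-\infty,+\infty]$ is $$V(x):=-\log|x|+\frac{x_1^2}{|x|^2}\quad\text{for }x=(x_1,x_2)\neq 0,\qquad V(0):=+\infty.$$ For a measure $\mu$, $(V*\mu)(x):=\int_{\mathbb{R}^2}V(x-y)\,d\mu(y)$. For compactly supported $\mu,\nu\in\mathcal{P}(\mathbb{R}^2)$ the integral $\int_{\mathbb{R}^2}(V*\mu)\,d\nu=\iint V(x-y)\,d\mu(y)\,d\nu(x)\in(-\infty,+\infty]$ is well defined, since $V$ is bounded from below on bounded sets. The integral in the claim is understood as $$\int_{\mathbb{R}^2} V*(\mu_1-\mu_0)\,d(\mu_1-\mu_0)=\int_{\mathbb{R}^2}(V*\mu_1)\,d\mu_1+\int_{\mathbb{R}^2}(V*\mu_0)\,d\mu_0-2\int_{\mathbb{R}^2}(V*\mu_1)\,d\mu_0 .$$ *)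

theory Defs
  imports "HOL-Probability.Probability"
begin

definition borel_prob_R2 :: "(real^2) measure set" where
  "borel_prob_R2 = {\<mu>. sets \<mu> = sets borel \<and> prob_space \<mu>}"

definition topological_support :: "(real^2) measure \<Rightarrow> (real^2) set" where
  "topological_support \<mu> = {x. \<forall>U. open U \<and> x \<in> U \<longrightarrow> emeasure \<mu> U > 0}"

definition V :: "real^2 \<Rightarrow> ereal" where
  "V x = (if x = 0 then \<infinity>
          else ereal (- ln (norm x) + (x $ 1)\<^sup>2 / (norm x)\<^sup>2))"

(* Integral of an extended-real function as the integral of its positive part minus that of its
   negative part. It is the usual integral whenever one of the two is finite; all integrals of V
   against compactly supported probability measures have a finite negative part, so the
   convention \<infinity> - \<infinity> = \<infinity> of type ereal plays no role for them. *)
definition ereal_integral :: "'a measure \<Rightarrow> ('a \<Rightarrow> ereal) \<Rightarrow> ereal" where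
  "ereal_integral M f =
     enn2ereal (\<integral>\<^sup>+ x. e2ennreal (max 0 (f x)) \<partial>M)
   - enn2ereal (\<integral>\<^sup>+ x. e2ennreal (max 0 (- f x)) \<partial>M)"

definition V_conv :: "(real^2) measure \<Rightarrow> real^2 \<Rightarrow> ereal" where
  "V_conv \<mu> x = ereal_integral \<mu> (\<lambda>y. V (x - y))"

definition interaction :: "(real^2) measure \<Rightarrow> (real^2) measure \<Rightarrow> ereal" where
  "interaction \<mu> \<nu> = ereal_integral \<nu> (V_conv \<mu>)"

(* The integral of V * (\<mu>1 - \<mu>0) against the signed measure \<mu>1 - \<mu>0, understood by expanding
   bilinearly. It is extended-real valued: for finite self-energies it would be -\<infinity> if the mixed
   term were infinite. *)
definition interaction_diff :: "(real^2) measure \<Rightarrow> (real^2) measure \<Rightarrow> ereal" where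
  "interaction_diff \<mu>1 \<mu>0 =
     interaction \<mu>1 \<mu>1 + interaction \<mu>0 \<mu>0 - 2 * interaction \<mu>1 \<mu>0"

end

theory Submission
  imports Defs
begin

text \<open>
  The potential is a superposition of Gaussian kernels over all scales \<open>t > 0\<close>. Writing
  \<open>x\<^sub>1\<^sup>2 / |x|\<^sup>2 = 1 - x\<^sub>2\<^sup>2 / |x|\<^sup>2\<close> and using a Frullani integral for the logarithm,
  \<open>V x + ln R = 1 + \<integral> ((exp (- t * |x|\<^sup>2) - exp (- t * R\<^sup>2)) / (2 * t) - x\<^sub>2\<^sup>2 * exp (- t * |x|\<^sup>2)) dt\<close>.
  Up to a constant depending on \<open>t\<close> and \<open>R\<close> only, the integrand is
  \<open>(1 / (2 * t) - x\<^sub>2\<^sup>2) * exp (- t * |x|\<^sup>2)\<close>, a negative multiple of the second vertical derivative of a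
  Gaussian. It is therefore the autocorrelation of the vertical derivative of a narrower Gaussian
  (\<open>gaussian_dipole_convolution\<close>), up to a positive factor, so its quadratic form on \<open>\<mu>\<^sub>1 - \<mu>\<^sub>0\<close> is a multiple of a squared
  \<open>L\<^sup>2\<close> norm, and the constants disappear because \<open>\<mu>\<^sub>1 - \<mu>\<^sub>0\<close> has total mass zero. Trading \<open>x\<^sub>1\<^sup>2\<close> for \<open>x\<^sub>2\<^sup>2\<close> is essential:
  the analogous kernels \<open>(1 / (2 * t) + x\<^sub>1\<^sup>2) * exp (- t * |x|\<^sup>2)\<close> represent the same potential, but
  they are not positive definite scale by scale.

  To integrate over the scales before the mixed energy is known to be finite, the logarithmic and
  the anisotropic parts are kept apart. If \<open>R\<close> bounds the distances between points of the supports,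
  both are nonnegative, and Tonelli applies in \<open>[0, \<infinity>]\<close>; the anisotropic energies are at most \<open>1\<close> and
  can be cancelled. The result (\<open>energy_scale_decomposition\<close>) says that the energy of \<open>\<mu>\<^sub>1 - \<mu>\<^sub>0\<close> is the
  integral over \<open>t\<close> of these quadratic forms; in particular the mixed energy is finite.

  If the energy vanishes, then at some scale the vertical derivative of the Gaussian convolution of
  \<open>\<mu>\<^sub>1 - \<mu>\<^sub>0\<close> is zero. The convolution is then constant on vertical lines, and it tends to zero along
  them, so it vanishes. Expanding the exponent turns this into the equality of the Laplace
  transforms of the two measures weighted by a Gaussian, and since the supports are compact the
  Stone-Weierstrass theorem gives \<open>\<mu>\<^sub>0 = \<mu>\<^sub>1\<close> (\<open>dipole_transform_injective\<close>).
\<close>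

section \<open>Measures determined by exponential integrals\<close>

text \<open>
  The indicator of a closed set \<open>C\<close> is the decreasing limit of the continuous functions
  \<open>max 0 (1 - n * dist(x, C))\<close>, and the closed sets form an intersection-stable generator of the
  Borel sets.
\<close>
lemma finite_measure_eqI_continuous:
  fixes M N :: "'a::metric_space measure"
  assumes M: "finite_measure M" "sets M = sets borel"
    and N: "finite_measure N" "sets N = sets borel"
    and eq: "\<And>f. continuous_on UNIV f \<Longrightarrow> (\<And>x. 0 \<le> f x) \<Longrightarrow> (\<And>x. f x \<le> (1::real))
      \<Longrightarrow> (\<integral>x. f x \<partial>M) = (\<integral>x. f x \<partial>N)"
  shows "M = N"
proof -
  interpret M: finite_measure M by fact
  interpret N: finite_measure N by fact
  have closed_eq: "emeasure M C = emeasure N C" if C: "closed C" for C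
  proof (cases "C = {}")
    case False
    define f where "f n x = max 0 (1 - real n * infdist x C)" for n x
    have cont: "continuous_on UNIV (f n)" for n
      unfolding f_def by (intro continuous_intros)
    have bd: "0 \<le> f n x" "f n x \<le> 1" for n x
      unfolding f_def using infdist_nonneg[of x C] by auto
    have lim: "(\<lambda>n. f n x) \<longlonglongrightarrow> indicator C x" for x
    proof (cases "x \<in> C")
      case True then show ?thesis by (simp add: f_def)
    next
      case x: False
      then have "0 < infdist x C"
        using C False infdist_nonneg[of x C] in_closed_iff_infdist_zero[of C x] by (auto simp: less_le)
      then have "\<forall>\<^sub>F n in sequentially. 1 < real n * infdist x C"
        by real_asymp
      then have "\<forall>\<^sub>F n in sequentially. f n x = 0"
        by eventually_elim (simp add: f_def)
      then show ?thesis using x by (simp add: tendsto_eventually)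
    qed
    have mM: "f n \<in> borel_measurable M" "f n \<in> borel_measurable N" for n
      using borel_measurable_continuous_onI[OF cont] M(2) N(2) by (auto cong: measurable_cong_sets)
    have CM: "C \<in> sets M" "C \<in> sets N" using C M(2) N(2) by auto
    have "(\<lambda>n. \<integral>x. f n x \<partial>M) \<longlonglongrightarrow> (\<integral>x. indicator C x \<partial>M)"
      by (rule integral_dominated_convergence[where w="\<lambda>_. 1"])
         (use CM mM lim bd in \<open>auto\<close>)
    moreover have "(\<lambda>n. \<integral>x. f n x \<partial>N) \<longlonglongrightarrow> (\<integral>x. indicator C x \<partial>N)"
      by (rule integral_dominated_convergence[where w="\<lambda>_. 1"])
         (use CM mM lim bd in \<open>auto\<close>)
    moreover have "(\<integral>x. f n x \<partial>M) = (\<integral>x. f n x \<partial>N)" for n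
      by (rule eq) (auto simp: cont bd)
    ultimately have "(\<integral>x. indicator C x \<partial>M) = (\<integral>x. (indicator C x :: real) \<partial>N)"
      by (auto intro: LIMSEQ_unique)
    then have "measure M C = measure N C" using CM sets.sets_into_space[of C M] sets.sets_into_space[of C N]
      by (simp add: Int_absorb2)
    then show ?thesis by (simp add: M.emeasure_eq_measure N.emeasure_eq_measure)
  qed simp
  show "M = N"
  proof (rule measure_eqI_generator_eq[where E="Collect closed" and \<Omega>=UNIV and A="\<lambda>_. UNIV"])
    show "Int_stable (Collect (closed :: 'a set \<Rightarrow> bool))" by (auto simp: Int_stable_def)
    show "sets M = sigma_sets UNIV (Collect closed)" "sets N = sigma_sets UNIV (Collect closed)"
      using M(2) N(2) by (auto simp: borel_eq_closed)
  qed (use closed_eq M.emeasure_finite in auto)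
qed

text \<open>
  The linear span of the exponentials \<open>x \<mapsto> exp (z \<bullet> x)\<close>. It is an algebra because a product of
  two exponentials is an exponential; this is what makes the Stone-Weierstrass theorem applicable.
\<close>
inductive exponential_sum :: "('a::real_inner \<Rightarrow> real) \<Rightarrow> bool" where
  exp_term: "exponential_sum (\<lambda>x. c * exp (z \<bullet> x))"
| add: "exponential_sum f \<Longrightarrow> exponential_sum g \<Longrightarrow> exponential_sum (\<lambda>x. f x + g x)"

lemma exponential_sum_mult:
  assumes "exponential_sum f" "exponential_sum g"
  shows "exponential_sum (\<lambda>x. f x * g x)"
  using assms
proof (induction f)
  case (exp_term c z)
  from exp_term show ?case
  proof (induction g)
    case (exp_term c' z')
    have "(\<lambda>x. c * exp (z \<bullet> x) * (c' * exp (z' \<bullet> x))) = (\<lambda>x. (c * c') * exp ((z + z') \<bullet> x))"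
      by (simp add: inner_add_left exp_add mult_ac)
    then show ?case by (simp only: exponential_sum.exp_term)
  qed (simp add: distrib_left exponential_sum.add)
qed (simp add: distrib_right exponential_sum.add)

lemma exponential_sum_continuous: "exponential_sum f \<Longrightarrow> continuous_on A f"
  by (induction rule: exponential_sum.induct) (auto intro!: continuous_intros)

text \<open>
  Stone-Weierstrass; the exponential in the direction \<open>x - y\<close> separates \<open>x\<close> from \<open>y\<close>.
\<close>
lemma exponential_sum_dense:
  fixes f :: "'a::euclidean_space \<Rightarrow> real"
  assumes "compact K" "continuous_on K f" "0 < e"
  shows "\<exists>g. exponential_sum g \<and> (\<forall>x\<in>K. \<bar>f x - g x\<bar> < e)"
proof (rule Stone_Weierstrass_HOL[OF assms(1) _ _ _ _ _ assms(2,3)])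
  fix c show "exponential_sum (\<lambda>x::'a. c)"
    using exponential_sum.exp_term[of c 0] by simp
next
  fix x y :: 'a assume "x \<in> K \<and> y \<in> K \<and> x \<noteq> y"
  then have "(x - y) \<bullet> x \<noteq> (x - y) \<bullet> y"
    by (metis inner_diff_right inner_eq_zero_iff right_minus_eq)
  then show "\<exists>f. exponential_sum f \<and> f x \<noteq> f y"
    by (intro exI[of _ "\<lambda>w. 1 * exp ((x - y) \<bullet> w)"] conjI exponential_sum.exp_term) simp
qed (auto intro: exponential_sum_continuous exponential_sum.add exponential_sum_mult)

lemma integrable_continuous_on_compact_carrier:
  fixes f :: "'a::metric_space \<Rightarrow> real"
  assumes "finite_measure M" "sets M = sets borel" "compact K" "AE x in M. x \<in> K"
    and "continuous_on UNIV f"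
  shows "integrable M f"
proof -
  interpret finite_measure M by fact
  have "bounded (f ` K)"
    by (intro compact_imp_bounded compact_continuous_image continuous_on_subset[OF assms(5)] assms) auto
  then obtain B where "\<And>x. x \<in> K \<Longrightarrow> norm (f x) \<le> B" by (auto simp: bounded_iff)
  moreover have "f \<in> borel_measurable M"
    using borel_measurable_continuous_onI[OF assms(5)] assms(2) by (auto cong: measurable_cong_sets)
  ultimately show ?thesis using assms(4) by (intro integrable_const_bound[of _ B]) auto
qed

text \<open>
  Equality of the weighted Laplace transforms extends by linearity to exponential sums. To reach a
  continuous \<open>f\<close>, one approximates \<open>f / q\<close> uniformly on \<open>K\<close> by an exponential sum \<open>g\<close>; then
  \<open>q * g\<close> differs from \<open>f\<close> by at most a small multiple of \<open>q\<close>, which is integrable.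
\<close>
lemma measure_eqI_laplace_transform:
  fixes M N :: "'a::euclidean_space measure"
  assumes M: "finite_measure M" "sets M = sets borel" "AE x in M. x \<in> K"
    and N: "finite_measure N" "sets N = sets borel" "AE x in N. x \<in> K"
    and K: "compact K" and q: "continuous_on UNIV q" "\<And>x. 0 < q x"
    and eq: "\<And>z. (\<integral>x. q x * exp (z \<bullet> x) \<partial>M) = (\<integral>x. q x * exp (z \<bullet> x) \<partial>N)"
  shows "M = N"
proof (rule finite_measure_eqI_continuous)
  note intM = integrable_continuous_on_compact_carrier[OF M(1,2) K M(3)]
  note intN = integrable_continuous_on_compact_carrier[OF N(1,2) K N(3)]
  have exp_eq: "(\<integral>x. q x * g x \<partial>M) = (\<integral>x. q x * g x \<partial>N)" if "exponential_sum g" for g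
    using that
  proof (induction g)
    case (exp_term c z)
    then show ?case using eq[of z] by (simp add: mult.left_commute)
  next
    case (add f g)
    have "continuous_on UNIV (\<lambda>x. q x * f x)" "continuous_on UNIV (\<lambda>x. q x * g x)"
      by (intro continuous_on_mult q exponential_sum_continuous add.hyps)+
    then show ?case using add by (simp add: distrib_left intM intN)
  qed
  fix f :: "'a \<Rightarrow> real" assume f: "continuous_on UNIV f"
  define I where "I = (\<integral>x. q x \<partial>M) + (\<integral>x. q x \<partial>N)"
  have I0: "0 \<le> I" unfolding I_def using q(2) by (intro add_nonneg_nonneg integral_nonneg_AE) (auto intro: less_imp_le)
  have "\<bar>(\<integral>x. f x \<partial>M) - (\<integral>x. f x \<partial>N)\<bar> \<le> e * I" if e: "0 < e" for e
  proof -
    have "continuous_on UNIV (\<lambda>x. f x / q x)"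
      by (intro continuous_intros f q) (metis q(2) less_irrefl)
    then obtain g where g: "exponential_sum g" "\<And>x. x \<in> K \<Longrightarrow> \<bar>f x / q x - g x\<bar> < e"
      using exponential_sum_dense[OF K _ e, of "\<lambda>x. f x / q x"] continuous_on_subset by blast
    have close: "\<bar>f x - q x * g x\<bar> \<le> e * q x" if "x \<in> K" for x
    proof -
      have "\<bar>f x - q x * g x\<bar> = q x * \<bar>f x / q x - g x\<bar>"
        using q(2)[of x] by (subst abs_of_pos[OF q(2)[of x], symmetric], subst abs_mult[symmetric])
          (simp add: right_diff_distrib)
      also have "\<dots> \<le> q x * e" using g(2)[OF that] q(2)[of x] by (intro mult_left_mono) auto
      finally show ?thesis by (simp add: mult.commute)
    qed
    have cg: "continuous_on UNIV (\<lambda>x. q x * g x)"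
      by (intro continuous_on_mult q exponential_sum_continuous g)
    have *: "\<bar>(\<integral>x. f x \<partial>L) - (\<integral>x. q x * g x \<partial>L)\<bar> \<le> e * (\<integral>x. q x \<partial>L)"
      if int: "\<And>h :: 'a \<Rightarrow> real. continuous_on UNIV h \<Longrightarrow> integrable L h" and AE: "AE x in L. x \<in> K" for L :: "'a measure"
    proof -
      have "\<bar>(\<integral>x. f x \<partial>L) - (\<integral>x. q x * g x \<partial>L)\<bar> = \<bar>\<integral>x. f x - q x * g x \<partial>L\<bar>"
        by (simp add: Bochner_Integration.integral_diff[OF int[OF f] int[OF cg]])
      also have "\<dots> \<le> (\<integral>x. \<bar>f x - q x * g x\<bar> \<partial>L)"
        by (rule integral_abs_bound)
      also have "\<dots> \<le> (\<integral>x. e * q x \<partial>L)"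
        using AE close by (intro integral_mono_AE int continuous_on_diff continuous_on_mult continuous_on_rabs continuous_on_const f cg q) auto
      finally show ?thesis by simp
    qed
    show ?thesis
      using *[OF intM M(3)] *[OF intN N(3)] exp_eq[OF g(1)]
      unfolding I_def by (simp add: algebra_simps abs_le_iff)
  qed
  note bound = this
  have "\<bar>(\<integral>x. f x \<partial>M) - (\<integral>x. f x \<partial>N)\<bar> \<le> 0"
  proof (rule field_le_epsilon)
    fix e :: real assume "0 < e"
    then have "\<bar>(\<integral>x. f x \<partial>M) - (\<integral>x. f x \<partial>N)\<bar> \<le> e / (I + 1) * I" using I0 by (intro bound) auto
    also have "\<dots> \<le> 0 + e" using I0 \<open>0 < e\<close> by (simp add: field_simps)
    finally show "\<bar>(\<integral>x. f x \<partial>M) - (\<integral>x. f x \<partial>N)\<bar> \<le> 0 + e" .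
  qed
  then show "(\<integral>x. f x \<partial>M) = (\<integral>x. f x \<partial>N)" by simp
qed (use M N in auto)

section \<open>Frullani integrals and Gaussian convolutions\<close>

lemma nn_integral_exp_decay:
  assumes "0 < u"
  shows "(\<integral>\<^sup>+t. ennreal (exp (- t * u)) * indicator {0<..} t \<partial>lborel) = ennreal (1 / u)"
proof -
  have "(\<integral>\<^sup>+t. ennreal (exp (- t * u)) * indicator {0<..} t \<partial>lborel)
      = (\<integral>\<^sup>+t. ennreal (exp (- t * u)) * indicator {0..} t \<partial>lborel)"
    by (intro nn_integral_cong_AE eventually_mono[OF AE_lborel_singleton[of 0]]) (auto split: split_indicator)
  also have "\<dots> = ennreal (0 - (- exp (- 0 * u) / u))"
  proof (rule nn_integral_FTC_atLeast[where F="\<lambda>t. - exp (- t * u) / u"])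
    show "((\<lambda>t. - exp (- t * u) / u) \<longlongrightarrow> 0) at_top"
      using assms by real_asymp
  qed (use assms in \<open>auto intro!: derivative_eq_intros\<close>)
  finally show ?thesis by simp
qed

text \<open>
  The integrand is \<open>\<integral> exp (- t * u) du\<close> over \<open>u\<close> in \<open>[p, q]\<close>; after exchanging the two integrals
  the inner one is \<open>1 / u\<close>.
\<close>
lemma frullani_exp:
  assumes p: "0 < p" "p \<le> q"
  shows "(\<integral>\<^sup>+t. ennreal ((exp (- t * p) - exp (- t * q)) / t) * indicator {0<..} t \<partial>lborel)
    = ennreal (ln (q / p))"
proof -
  let ?f = "\<lambda>t u. ennreal (exp (- t * u)) * indicator {p..q} u * indicator {0<..} t"
  have "ennreal ((exp (- t * p) - exp (- t * q)) / t) = (\<integral>\<^sup>+u. ennreal (exp (- t * u)) * indicator {p..q} u \<partial>lborel)"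
    if "0 < t" for t
  proof -
    have "(\<integral>\<^sup>+u. ennreal (exp (- t * u)) * indicator {p..q} u \<partial>lborel) = ennreal (- exp (- t * q) / t - (- exp (- t * p) / t))"
      by (rule nn_integral_FTC_Icc[where F="\<lambda>u. - exp (- t * u) / t"])
         (use that p in \<open>auto intro!: derivative_eq_intros\<close>)
    then show ?thesis by (simp add: diff_divide_distrib)
  qed
  then have "(\<integral>\<^sup>+t. ennreal ((exp (- t * p) - exp (- t * q)) / t) * indicator {0<..} t \<partial>lborel)
      = (\<integral>\<^sup>+t. \<integral>\<^sup>+u. ?f t u \<partial>lborel \<partial>lborel)"
    by (intro nn_integral_cong) (auto split: split_indicator)
  also have "\<dots> = (\<integral>\<^sup>+u. \<integral>\<^sup>+t. ?f t u \<partial>lborel \<partial>lborel)"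
    by (rule lborel_pair.Fubini') measurable
  also have "\<dots> = (\<integral>\<^sup>+u. ennreal (1 / u) * indicator {p..q} u \<partial>lborel)"
  proof (intro nn_integral_cong)
    fix u :: real
    show "(\<integral>\<^sup>+t. ?f t u \<partial>lborel) = ennreal (1 / u) * indicator {p..q} u"
    proof (cases "u \<in> {p..q}")
      case True
      then have "0 < u" using p by auto
      then show ?thesis using nn_integral_exp_decay[of u] True by simp
    qed simp
  qed
  also have "\<dots> = ennreal (ln q - ln p)"
    by (rule nn_integral_FTC_Icc[where F=ln]) (use p in \<open>auto intro!: derivative_eq_intros\<close>)
  finally show ?thesis using p by (simp add: ln_div)
qed

text \<open>
  The integrand dominates the one of the previous lemma for every \<open>p\<close> in \<open>(0, q]\<close>, whose integral
  \<open>ln (q / p)\<close> is unbounded as \<open>p\<close> tends to \<open>0\<close>. This is the singularity of the potential at the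
  origin.
\<close>
lemma frullani_exp_zero:
  assumes q: "0 < q"
  shows "(\<integral>\<^sup>+t. ennreal ((1 - exp (- t * q)) / t) * indicator {0<..} t \<partial>lborel) = \<infinity>"
proof -
  let ?I = "\<integral>\<^sup>+t. ennreal ((1 - exp (- t * q)) / t) * indicator {0<..} t \<partial>lborel"
  have "ennreal (real n) \<le> ?I" for n
  proof -
    \<comment> \<open>chosen so that \<open>ln (q / p) = n\<close>\<close>
    define p where "p = q * exp (- real n)"
    have p: "0 < p" "p \<le> q" using q by (auto simp: p_def)
    have "ennreal (real n) = ennreal (ln (q / p))"
      using q by (simp add: p_def exp_minus field_simps)
    also have "\<dots> = (\<integral>\<^sup>+t. ennreal ((exp (- t * p) - exp (- t * q)) / t) * indicator {0<..} t \<partial>lborel)"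
      using frullani_exp[OF p] by simp
    also have "\<dots> \<le> ?I"
      using p by (intro nn_integral_mono) (auto split: split_indicator intro!: ennreal_leI divide_right_mono)
    finally show ?thesis .
  qed
  note lower = this
  show ?thesis
  proof (rule ccontr)
    assume "?I \<noteq> \<infinity>"
    then obtain n :: nat where "?I < of_nat n"
      using ennreal_Ex_less_of_nat by (auto simp: less_top)
    with lower[of n] show False by (simp add: ennreal_of_nat_eq_real_of_nat)
  qed
qed

lemma has_bochner_integral_pair_mult:
  fixes f g :: "_ \<Rightarrow> real"
  assumes "sigma_finite_measure M" "sigma_finite_measure N"
    and f: "has_bochner_integral M f a" and g: "has_bochner_integral N g b"
  shows "has_bochner_integral (M \<Otimes>\<^sub>M N) (\<lambda>(x, y). f x * g y) (a * b)"
proof -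
  interpret M: sigma_finite_measure M by fact
  interpret N: sigma_finite_measure N by fact
  interpret pair_sigma_finite M N ..
  have [measurable]: "f \<in> borel_measurable M" "g \<in> borel_measurable N"
    and int: "integrable M f" "integrable N g"
    and val: "(\<integral>x. f x \<partial>M) = a" "(\<integral>x. g x \<partial>N) = b"
    using f g by (auto simp: has_bochner_integral_iff)
  have I: "integrable (M \<Otimes>\<^sub>M N) (\<lambda>(x, y). f x * g y)"
  proof (rule Fubini_integrable)
    show "integrable M (\<lambda>x. \<integral>y. norm (case (x, y) of (x, y) \<Rightarrow> f x * g y) \<partial>N)"
      using int by (simp add: abs_mult)
  qed (use int in auto)
  have "(\<integral>z. (case z of (x, y) \<Rightarrow> f x * g y) \<partial>(M \<Otimes>\<^sub>M N)) = a * b"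
    using integral_fst'[OF I] val by simp
  with I show ?thesis by (simp add: has_bochner_integral_iff)
qed

text \<open>
  Completing the square: \<open>(x - a)\<^sup>2 + (y - a)\<^sup>2 = (x - y)\<^sup>2 / 2 + 2 * (a - (x + y) / 2)\<^sup>2\<close>. The
  dependence on \<open>a\<close> is thus that of a normal density with mean \<open>(x + y) / 2\<close> and variance
  \<open>1 / (4 * s)\<close>, so that integrals over \<open>a\<close> become moments of that density.
\<close>
lemma gaussian_product:
  fixes x y a s :: real
  assumes "0 < s"
  shows "exp (- s * (x - a)\<^sup>2) * exp (- s * (y - a)\<^sup>2)
    = sqrt (pi / (2 * s)) * exp (- s / 2 * (x - y)\<^sup>2) * normal_density ((x + y) / 2) (1 / (2 * sqrt s)) a"
proof -
  have "- s * (x - a)\<^sup>2 + - s * (y - a)\<^sup>2 = - s / 2 * (x - y)\<^sup>2 + - 2 * s * (a - (x + y) / 2)\<^sup>2"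
    by (simp add: power2_eq_square field_simps)
  then have "exp (- s * (x - a)\<^sup>2) * exp (- s * (y - a)\<^sup>2)
      = exp (- s / 2 * (x - y)\<^sup>2) * exp (- 2 * s * (a - (x + y) / 2)\<^sup>2)"
    by (simp only: exp_add[symmetric])
  also have "exp (- 2 * s * (a - (x + y) / 2)\<^sup>2)
      = sqrt (pi / (2 * s)) * normal_density ((x + y) / 2) (1 / (2 * sqrt s)) a"
    using assms by (simp add: normal_density_def power_divide real_sqrt_divide real_sqrt_mult power_mult_distrib)
  finally show ?thesis by (simp only: mult_ac)
qed

lemma gaussian_convolution:
  assumes s: "0 < s"
  shows "has_bochner_integral lborel (\<lambda>a. exp (- s * (x - a)\<^sup>2) * exp (- s * (y - a)\<^sup>2))
    (sqrt (pi / (2 * s)) * exp (- s / 2 * (x - y)\<^sup>2))"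
proof -
  have \<sigma>: "0 < 1 / (2 * sqrt s)" using s by simp
  have "has_bochner_integral lborel (normal_density ((x + y) / 2) (1 / (2 * sqrt s))) 1"
    using normal_moment_even[OF \<sigma>, of "(x + y) / 2" 0] by simp
  from has_bochner_integral_mult_right[OF this, of "sqrt (pi / (2 * s)) * exp (- s / 2 * (x - y)\<^sup>2)"]
  show ?thesis
    by (simp only: gaussian_product[OF s] mult_1_right)
qed

text \<open>
  With \<open>m = (x + y) / 2\<close> one has \<open>(x - b) * (y - b) = (b - m)\<^sup>2 - (x - y)\<^sup>2 / 4\<close>, and the first
  summand contributes the variance of the normal density.
\<close>
lemma gaussian_derivative_convolution:
  assumes s: "0 < s"
  shows "has_bochner_integral lborel
    (\<lambda>b. ((x - b) * exp (- s * (x - b)\<^sup>2)) * ((y - b) * exp (- s * (y - b)\<^sup>2)))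
    (sqrt (pi / (2 * s)) * exp (- s / 2 * (x - y)\<^sup>2) * (1 / (4 * s) - (x - y)\<^sup>2 / 4))"
proof -
  have \<sigma>: "0 < 1 / (2 * sqrt s)" using s by simp
  let ?n = "normal_density ((x + y) / 2) (1 / (2 * sqrt s))"
  let ?c = "sqrt (pi / (2 * s)) * exp (- s / 2 * (x - y)\<^sup>2)"
  have m0: "has_bochner_integral lborel ?n 1"
    using normal_moment_even[OF \<sigma>, of "(x + y) / 2" 0] by simp
  have m2: "has_bochner_integral lborel (\<lambda>b. ?n b * (b - (x + y) / 2)\<^sup>2) (1 / (4 * s))"
    using normal_moment_even[OF \<sigma>, of "(x + y) / 2" 1] s by (simp add: power_divide power_mult_distrib)
  have "has_bochner_integral lborel
      (\<lambda>b. ?c * (?n b * (b - (x + y) / 2)\<^sup>2 - (x - y)\<^sup>2 / 4 * ?n b)) (?c * (1 / (4 * s) - (x - y)\<^sup>2 / 4 * 1))"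
    by (intro has_bochner_integral_mult_right has_bochner_integral_diff m0 m2)
  also have "(\<lambda>b. ?c * (?n b * (b - (x + y) / 2)\<^sup>2 - (x - y)\<^sup>2 / 4 * ?n b))
      = (\<lambda>b. ((x - b) * exp (- s * (x - b)\<^sup>2)) * ((y - b) * exp (- s * (y - b)\<^sup>2)))"
  proof
    fix b
    have "((x - b) * exp (- s * (x - b)\<^sup>2)) * ((y - b) * exp (- s * (y - b)\<^sup>2))
        = ((x - b) * (y - b)) * (exp (- s * (x - b)\<^sup>2) * exp (- s * (y - b)\<^sup>2))"
      by (simp only: mult_ac)
    also have "(x - b) * (y - b) = (b - (x + y) / 2)\<^sup>2 - (x - y)\<^sup>2 / 4"
      by (simp add: power2_eq_square field_simps)
    finally show "?c * (?n b * (b - (x + y) / 2)\<^sup>2 - (x - y)\<^sup>2 / 4 * ?n b)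
        = ((x - b) * exp (- s * (x - b)\<^sup>2)) * ((y - b) * exp (- s * (y - b)\<^sup>2))"
      unfolding gaussian_product[OF s] by (simp only: algebra_simps)
  qed
  finally show ?thesis by (simp only: mult_1_right)
qed

section \<open>Positive definiteness at one scale\<close>

text \<open>
  A kernel of the form \<open>k(x, y) = \<integral> \<psi> x \<omega> * \<psi> y \<omega> d\<omega>\<close> is positive definite because its mixed
  energies are \<open>L\<^sup>2\<close> inner products of the transforms \<open>\<omega> \<mapsto> \<integral> \<psi> x \<omega> d\<mu>(x)\<close>. The uniform bound on the
  \<open>L\<^sup>2\<close> norms of the functions \<open>\<psi> x\<close> justifies Fubini, via \<open>|u * v| \<le> u\<^sup>2 + v\<^sup>2\<close>.
\<close>
lemma energy_of_feature_kernel: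
  fixes \<mu> \<nu> :: "'a::topological_space measure" and M :: "'b measure" and \<psi> :: "'a \<Rightarrow> 'b \<Rightarrow> real"
  assumes \<mu>: "finite_measure \<mu>" "sets \<mu> = sets borel" and \<nu>: "finite_measure \<nu>" "sets \<nu> = sets borel"
    and M: "sigma_finite_measure M"
    and \<psi>: "case_prod \<psi> \<in> borel_measurable (borel \<Otimes>\<^sub>M M)" and bd: "\<And>x \<omega>. \<bar>\<psi> x \<omega>\<bar> \<le> B"
    and sq: "\<And>x. integrable M (\<lambda>\<omega>. (\<psi> x \<omega>)\<^sup>2)" "\<And>x. (\<integral>\<omega>. (\<psi> x \<omega>)\<^sup>2 \<partial>M) \<le> C"
  shows "integrable M (\<lambda>\<omega>. (\<integral>x. \<psi> x \<omega> \<partial>\<mu>) * (\<integral>y. \<psi> y \<omega> \<partial>\<nu>))" (is ?int)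
    and "(\<integral>z. (\<integral>\<omega>. \<psi> (fst z) \<omega> * \<psi> (snd z) \<omega> \<partial>M) \<partial>(\<mu> \<Otimes>\<^sub>M \<nu>))
      = (\<integral>\<omega>. (\<integral>x. \<psi> x \<omega> \<partial>\<mu>) * (\<integral>y. \<psi> y \<omega> \<partial>\<nu>) \<partial>M)" (is ?eq)
proof -
  interpret \<mu>: finite_measure \<mu> by fact
  interpret \<nu>: finite_measure \<nu> by fact
  interpret M: sigma_finite_measure M by fact
  interpret P: pair_sigma_finite \<mu> \<nu> ..
  interpret P: finite_measure "\<mu> \<Otimes>\<^sub>M \<nu>" by (rule finite_measure_pair_measure; fact)
  interpret PM: pair_sigma_finite "\<mu> \<Otimes>\<^sub>M \<nu>" M ..
  have meas: "(\<lambda>w. \<psi> (f w) (g w)) \<in> borel_measurable L"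
    if "f \<in> borel_measurable L" "g \<in> measurable L M" for f g and L :: "'c measure"
    using measurable_compose[OF measurable_Pair[OF that] \<psi>] by simp
  have fst_b: "fst \<in> borel_measurable (\<mu> \<Otimes>\<^sub>M \<nu>)" and snd_b: "snd \<in> borel_measurable (\<mu> \<Otimes>\<^sub>M \<nu>)"
    using measurable_fst[of \<mu> \<nu>] measurable_snd[of \<mu> \<nu>] \<mu>(2) \<nu>(2) by (auto cong: measurable_cong_sets)
  have id_b: "(\<lambda>x. x) \<in> borel_measurable \<mu>" "(\<lambda>x. x) \<in> borel_measurable \<nu>"
    using \<mu>(2) \<nu>(2) by (auto intro: measurable_ident_sets)
  let ?g = "\<lambda>z \<omega>. \<psi> (fst z) \<omega> * \<psi> (snd z) \<omega>"
  let ?f = "case_prod ?g"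
  have f[measurable]: "?f \<in> borel_measurable ((\<mu> \<Otimes>\<^sub>M \<nu>) \<Otimes>\<^sub>M M)"
    unfolding split_beta'
    by (intro borel_measurable_times meas measurable_compose[OF measurable_fst] fst_b snd_b measurable_snd)
  have \<psi>x: "\<psi> x \<in> borel_measurable M" for x
    by (rule meas) auto
  have amgm: "\<bar>\<psi> x \<omega> * \<psi> y \<omega>\<bar> \<le> (\<psi> x \<omega>)\<^sup>2 + (\<psi> y \<omega>)\<^sup>2" for x y \<omega>
  proof -
    have "2 * \<bar>\<psi> x \<omega>\<bar> * \<bar>\<psi> y \<omega>\<bar> \<le> (\<psi> x \<omega>)\<^sup>2 + (\<psi> y \<omega>)\<^sup>2"
      using sum_squares_bound[of "\<bar>\<psi> x \<omega>\<bar>" "\<bar>\<psi> y \<omega>\<bar>"] by (simp only: power2_abs)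
    moreover have "0 \<le> \<bar>\<psi> x \<omega>\<bar> * \<bar>\<psi> y \<omega>\<bar>" by (intro mult_nonneg_nonneg abs_ge_zero)
    ultimately show ?thesis unfolding abs_mult by linarith
  qed
  have int_prod: "integrable M (\<lambda>\<omega>. \<psi> x \<omega> * \<psi> y \<omega>)" for x y
    by (rule Bochner_Integration.integrable_bound[OF Bochner_Integration.integrable_add[OF sq(1)[of x] sq(1)[of y]]])
       (use \<psi>x amgm in auto)
  have bound: "(\<integral>\<omega>. \<bar>\<psi> x \<omega> * \<psi> y \<omega>\<bar> \<partial>M) \<le> C + C" for x y
  proof -
    have "(\<integral>\<omega>. \<bar>\<psi> x \<omega> * \<psi> y \<omega>\<bar> \<partial>M) \<le> (\<integral>\<omega>. (\<psi> x \<omega>)\<^sup>2 + (\<psi> y \<omega>)\<^sup>2 \<partial>M)"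
      by (intro integral_mono amgm integrable_abs int_prod Bochner_Integration.integrable_add sq)
    also have "\<dots> = (\<integral>\<omega>. (\<psi> x \<omega>)\<^sup>2 \<partial>M) + (\<integral>\<omega>. (\<psi> y \<omega>)\<^sup>2 \<partial>M)"
      by (intro Bochner_Integration.integral_add sq)
    finally show ?thesis using sq(2)[of x] sq(2)[of y] by linarith
  qed
  have I: "integrable ((\<mu> \<Otimes>\<^sub>M \<nu>) \<Otimes>\<^sub>M M) ?f"
  proof (rule PM.Fubini_integrable[OF f])
    show "integrable (\<mu> \<Otimes>\<^sub>M \<nu>) (\<lambda>z. \<integral>\<omega>. norm (?f (z, \<omega>)) \<partial>M)"
    proof (rule P.integrable_const_bound[where B="C + C"])
      show "AE z in \<mu> \<Otimes>\<^sub>M \<nu>. norm (\<integral>\<omega>. norm (?f (z, \<omega>)) \<partial>M) \<le> C + C"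
        using bound by auto
    qed measurable
  qed (use int_prod in auto)
  have int_\<mu>: "integrable \<mu> (\<lambda>x. \<psi> x \<omega>)" "integrable \<nu> (\<lambda>x. \<psi> x \<omega>)" if "\<omega> \<in> space M" for \<omega>
    using that bd
    by (auto intro!: \<mu>.integrable_const_bound[of _ B] \<nu>.integrable_const_bound[of _ B] meas id_b)
  have inner: "(\<integral>z. ?g z \<omega> \<partial>(\<mu> \<Otimes>\<^sub>M \<nu>)) = (\<integral>x. \<psi> x \<omega> \<partial>\<mu>) * (\<integral>y. \<psi> y \<omega> \<partial>\<nu>)"
    if "\<omega> \<in> space M" for \<omega>
    using has_bochner_integral_integral_eq[OF has_bochner_integral_pair_mult[OF \<mu>.sigma_finite_measure_axioms
      \<nu>.sigma_finite_measure_axioms has_bochner_integral_integrable[OF int_\<mu>(1)[OF that]]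
      has_bochner_integral_integrable[OF int_\<mu>(2)[OF that]]]]
    by (simp add: split_beta')
  show ?int
    using PM.integrable_snd[OF I] by (rule Bochner_Integration.integrable_cong[OF refl inner, THEN iffD1, rotated])
  show ?eq
    unfolding PM.Fubini_integral[OF I, symmetric] by (rule Bochner_Integration.integral_cong[OF refl inner])
qed

text \<open>
  Up to a constant factor, the vertical derivative of a Gaussian centred at \<open>\<omega>\<close>.
\<close>
definition gaussian_dipole :: "real \<Rightarrow> real^2 \<Rightarrow> real \<times> real \<Rightarrow> real" where
  "gaussian_dipole s x \<omega> = exp (- s * (x $ 1 - fst \<omega>)\<^sup>2) *
     ((x $ 2 - snd \<omega>) * exp (- s * (x $ 2 - snd \<omega>)\<^sup>2))"

lemma norm_real2_squared: "(norm (x :: real^2))\<^sup>2 = (x $ 1)\<^sup>2 + (x $ 2)\<^sup>2"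
  by (simp only: power2_norm_eq_inner inner_vec_def sum_2) (simp add: power2_eq_square)

text \<open>
  This is \<open>- 1 / (4 * t\<^sup>2)\<close> times the second derivative of \<open>exp (- t * |x|\<^sup>2)\<close> in the second variable,
  hence an autocorrelation of the derivative of a narrower Gaussian.
\<close>
definition scale_kernel :: "real \<Rightarrow> real^2 \<Rightarrow> real" where
  "scale_kernel t x = (1 / (2 * t) - (x $ 2)\<^sup>2) * exp (- t * (norm x)\<^sup>2)"

text \<open>
  The two coordinates separate. The width parameter is \<open>2 * t\<close> because the autocorrelation of a
  Gaussian has half its exponent.
\<close>
lemma gaussian_dipole_convolution:
  assumes t: "0 < t"
  shows "has_bochner_integral lborel
    (\<lambda>\<omega>. gaussian_dipole (2 * t) x \<omega> * gaussian_dipole (2 * t) y \<omega>) (pi / (16 * t) * scale_kernel t (x - y))"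
proof -
  have s: "0 < 2 * t" using t by simp
  have "(\<lambda>\<omega>. gaussian_dipole (2 * t) x \<omega> * gaussian_dipole (2 * t) y \<omega>)
    = (\<lambda>(a, b). (exp (- (2 * t) * (x $ 1 - a)\<^sup>2) * exp (- (2 * t) * (y $ 1 - a)\<^sup>2)) *
      (((x $ 2 - b) * exp (- (2 * t) * (x $ 2 - b)\<^sup>2)) * ((y $ 2 - b) * exp (- (2 * t) * (y $ 2 - b)\<^sup>2))))"
    by (auto simp: gaussian_dipole_def fun_eq_iff mult_ac)
  moreover have "sqrt (pi / (2 * (2 * t))) * exp (- (2 * t) / 2 * (x $ 1 - y $ 1)\<^sup>2) *
      (sqrt (pi / (2 * (2 * t))) * exp (- (2 * t) / 2 * (x $ 2 - y $ 2)\<^sup>2) * (1 / (4 * (2 * t)) - (x $ 2 - y $ 2)\<^sup>2 / 4))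
    = pi / (16 * t) * scale_kernel t (x - y)" (is "?c * ?e1 * (?c * ?e2 * ?r) = _")
  proof -
    have "?c * ?c = pi / (4 * t)" using t by simp
    moreover have "?e1 * ?e2 = exp (- t * (norm (x - y))\<^sup>2)"
      by (simp add: norm_real2_squared exp_add[symmetric] algebra_simps)
    moreover have "?r = 1 / 4 * (1 / (2 * t) - (x $ 2 - y $ 2)\<^sup>2)"
      using t by (simp add: field_simps)
    moreover have "?c * ?e1 * (?c * ?e2 * ?r) = (?c * ?c) * (?e1 * ?e2) * ?r"
      by (simp only: mult_ac)
    ultimately have "?c * ?e1 * (?c * ?e2 * ?r)
        = pi / (4 * t) * exp (- t * (norm (x - y))\<^sup>2) * (1 / 4 * (1 / (2 * t) - (x $ 2 - y $ 2)\<^sup>2))"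
      by (simp only:)
    then show ?thesis by (simp add: scale_kernel_def)
  qed
  ultimately show ?thesis
    using has_bochner_integral_pair_mult[OF lborel.sigma_finite_measure_axioms lborel.sigma_finite_measure_axioms
      gaussian_convolution[OF s, of "x $ 1" "y $ 1"] gaussian_derivative_convolution[OF s, of "x $ 2" "y $ 2"]]
    unfolding lborel_prod by (simp only:)
qed

lemma gaussian_dipole_bounded:
  assumes "0 < s"
  shows "\<bar>gaussian_dipole s x \<omega>\<bar> \<le> 1 + 1 / s"
proof -
  let ?u = "x $ 2 - snd \<omega>"
  have le: "b \<le> 1 + c" if "2 * b \<le> c + 1" "0 \<le> b" for b c :: real
    using that by linarith
  have "\<bar>?u\<bar> \<le> 1 + ?u\<^sup>2"
    by (rule le) (use sum_squares_bound[of "\<bar>?u\<bar>" 1] in simp_all)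
  also have "\<dots> \<le> (1 + 1 / s) * (1 + s * ?u\<^sup>2)"
    using assms by (simp add: field_simps)
  also have "\<dots> \<le> (1 + 1 / s) * exp (s * ?u\<^sup>2)"
    using assms exp_ge_add_one_self[of "s * ?u\<^sup>2"] by (intro mult_left_mono) auto
  finally have "\<bar>?u\<bar> * exp (- s * ?u\<^sup>2) \<le> 1 + 1 / s"
    by (simp add: exp_minus field_simps)
  moreover have "exp (- s * (x $ 1 - fst \<omega>)\<^sup>2) \<le> 1" using assms by simp
  ultimately have "exp (- s * (x $ 1 - fst \<omega>)\<^sup>2) * (\<bar>?u\<bar> * exp (- s * ?u\<^sup>2)) \<le> 1 * (1 + 1 / s)"
    by (intro mult_mono) auto
  then show ?thesis by (simp add: gaussian_dipole_def abs_mult)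
qed

lemma gaussian_dipole_continuous:
  assumes "continuous_on A f" "continuous_on A g"
  shows "continuous_on A (\<lambda>w. gaussian_dipole s (f w) (g w))"
  unfolding gaussian_dipole_def by (intro continuous_intros assms)

definition dipole_transform :: "real \<Rightarrow> (real^2) measure \<Rightarrow> real \<times> real \<Rightarrow> real" where
  "dipole_transform s \<mu> \<omega> = (\<integral>x. gaussian_dipole s x \<omega> \<partial>\<mu>)"

lemma scale_kernel_energy:
  assumes \<mu>: "finite_measure \<mu>" "sets \<mu> = sets borel" and \<nu>: "finite_measure \<nu>" "sets \<nu> = sets borel"
    and t: "0 < t"
  shows "integrable lborel (\<lambda>\<omega>. dipole_transform (2 * t) \<mu> \<omega> * dipole_transform (2 * t) \<nu> \<omega>)"
    and "(\<integral>z. scale_kernel t (fst z - snd z) \<partial>(\<mu> \<Otimes>\<^sub>M \<nu>)) = 16 * t / pi *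
      (\<integral>\<omega>. dipole_transform (2 * t) \<mu> \<omega> * dipole_transform (2 * t) \<nu> \<omega> \<partial>lborel)"
proof -
  let ?\<psi> = "gaussian_dipole (2 * t)"
  note conv = gaussian_dipole_convolution[OF t, THEN has_bochner_integral_integral_eq]
  have sets_eq: "sets (borel \<Otimes>\<^sub>M lborel) = sets (borel :: ((real^2) \<times> real \<times> real) measure)"
    by (subst sets_pair_measure_cong[OF refl sets_lborel]) (simp only: borel_prod)
  have "case_prod ?\<psi> \<in> borel_measurable borel"
    unfolding split_beta'
    by (intro borel_measurable_continuous_onI gaussian_dipole_continuous continuous_intros)
  then have m: "case_prod ?\<psi> \<in> borel_measurable (borel \<Otimes>\<^sub>M lborel)"
    by (simp only: measurable_cong_sets[OF sets_eq refl])
  have sq: "integrable lborel (\<lambda>\<omega>. (?\<psi> x \<omega>)\<^sup>2)"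
    "(\<integral>\<omega>. (?\<psi> x \<omega>)\<^sup>2 \<partial>lborel) \<le> pi / (16 * t) * scale_kernel t 0" for x
    using gaussian_dipole_convolution[OF t, of x x] by (auto simp: has_bochner_integral_iff power2_eq_square)
  note * = energy_of_feature_kernel[OF \<mu> \<nu> lborel.sigma_finite_measure_axioms m gaussian_dipole_bounded sq]
  show "integrable lborel (\<lambda>\<omega>. dipole_transform (2 * t) \<mu> \<omega> * dipole_transform (2 * t) \<nu> \<omega>)"
    unfolding dipole_transform_def by (rule *(1)) (use t in simp)
  have "pi / (16 * t) * (\<integral>z. scale_kernel t (fst z - snd z) \<partial>(\<mu> \<Otimes>\<^sub>M \<nu>))
      = (\<integral>\<omega>. dipole_transform (2 * t) \<mu> \<omega> * dipole_transform (2 * t) \<nu> \<omega> \<partial>lborel)"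
    unfolding dipole_transform_def using *(2) t by (simp add: conv)
  then show "(\<integral>z. scale_kernel t (fst z - snd z) \<partial>(\<mu> \<Otimes>\<^sub>M \<nu>)) = 16 * t / pi *
      (\<integral>\<omega>. dipole_transform (2 * t) \<mu> \<omega> * dipole_transform (2 * t) \<nu> \<omega> \<partial>lborel)"
    using t by (simp add: field_simps)
qed

section \<open>Injectivity of the dipole transform\<close>

lemma gaussian_dipole_measurable:
  assumes "sets \<mu> = sets (borel :: (real^2) measure)"
  shows "(\<lambda>x. gaussian_dipole s x \<omega>) \<in> borel_measurable \<mu>"
  using borel_measurable_continuous_onI[OF gaussian_dipole_continuous[OF continuous_on_id continuous_on_const]] assms
  by (simp cong: measurable_cong_sets)

lemma dipole_transform_continuous:
  assumes \<mu>: "finite_measure \<mu>" "sets \<mu> = sets borel" and s: "0 < s"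
  shows "continuous_on UNIV (dipole_transform s \<mu>)"
proof (rule continuous_on_sequentiallyI)
  interpret finite_measure \<mu> by fact
  fix u and \<omega> :: "real \<times> real" assume u: "u \<longlonglongrightarrow> \<omega>"
  show "(\<lambda>n. dipole_transform s \<mu> (u n)) \<longlonglongrightarrow> dipole_transform s \<mu> \<omega>"
    unfolding dipole_transform_def
  proof (rule integral_dominated_convergence[where w="\<lambda>_. 1 + 1 / s"])
    show "AE x in \<mu>. (\<lambda>n. gaussian_dipole s x (u n)) \<longlonglongrightarrow> gaussian_dipole s x \<omega>"
    proof (intro AE_I2)
      fix x
      have "isCont (gaussian_dipole s x) \<omega>"
        using gaussian_dipole_continuous[of UNIV "\<lambda>_. x" "\<lambda>\<omega>. \<omega>" s]
        by (metis UNIV_I continuous_on_eq_continuous_at continuous_on_const continuous_on_id open_UNIV)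
      then show "(\<lambda>n. gaussian_dipole s x (u n)) \<longlonglongrightarrow> gaussian_dipole s x \<omega>"
        using u isCont_tendsto_compose by blast
    qed
  qed (use gaussian_dipole_measurable[OF \<mu>(2)] gaussian_dipole_bounded[OF s] in auto)
qed

definition gaussian_transform :: "real \<Rightarrow> (real^2) measure \<Rightarrow> real \<Rightarrow> real \<Rightarrow> real" where
  "gaussian_transform s \<mu> a b = (\<integral>x. exp (- s * (x $ 1 - a)\<^sup>2) * exp (- s * (x $ 2 - b)\<^sup>2) \<partial>\<mu>)"

lemma gaussian_product_le_1:
  fixes u v :: real
  assumes "0 < s"
  shows "exp (- s * u\<^sup>2) * exp (- s * v\<^sup>2) \<le> 1"
  using assms by (intro mult_le_one) auto

lemma gaussian_transform_integrable:
  assumes \<mu>: "finite_measure \<mu>" "sets \<mu> = sets borel" and s: "0 < s"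
  shows "integrable \<mu> (\<lambda>x::real^2. exp (- s * (x $ 1 - a)\<^sup>2) * exp (- s * (x $ 2 - b)\<^sup>2))"
proof (rule finite_measure.integrable_const_bound[OF \<mu>(1), of _ 1])
  have "continuous_on UNIV (\<lambda>x::real^2. exp (- s * (x $ 1 - a)\<^sup>2) * exp (- s * (x $ 2 - b)\<^sup>2))"
    by (intro continuous_intros)
  from borel_measurable_continuous_onI[OF this]
  show "(\<lambda>x::real^2. exp (- s * (x $ 1 - a)\<^sup>2) * exp (- s * (x $ 2 - b)\<^sup>2)) \<in> borel_measurable \<mu>"
    using \<mu>(2) by (simp cong: measurable_cong_sets)
  show "AE x in \<mu>. norm (exp (- s * (x $ 1 - a)\<^sup>2) * exp (- s * (x $ 2 - b)\<^sup>2)) \<le> 1"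
    using gaussian_product_le_1[OF s] by (intro AE_I2) (simp only: abs_mult abs_exp_cancel real_norm_def)
qed

text \<open>
  Differentiating the Gaussian in its centre \<open>b\<close> gives \<open>2 * s\<close> times the dipole; this is the
  fundamental theorem of calculus under the integral over \<open>\<mu>\<close>.
\<close>
lemma gaussian_transform_diff:
  assumes \<mu>: "finite_measure \<mu>" "sets \<mu> = sets borel" and s: "0 < s" and b: "b \<le> b'"
  shows "gaussian_transform s \<mu> a b' - gaussian_transform s \<mu> a b
    = (\<integral>\<beta>. 2 * s * dipole_transform s \<mu> (a, \<beta>) * indicator {b..b'} \<beta> \<partial>lborel)"
proof -
  interpret \<mu>: finite_measure \<mu> by fact
  interpret P: pair_sigma_finite \<mu> "lborel :: real measure" ..
  let ?e = "\<lambda>x \<beta>. exp (- s * (x $ 1 - a)\<^sup>2) * exp (- s * (x $ 2 - \<beta>)\<^sup>2)"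
  let ?g = "\<lambda>x \<beta>. 2 * s * gaussian_dipole s x (a, \<beta>) * indicator {b..b'} \<beta>"
  have ftc: "(\<integral>\<beta>. ?g x \<beta> \<partial>lborel) = ?e x b' - ?e x b" for x :: "real^2"
    by (rule integral_FTC_Icc_real[OF b, where F="\<lambda>\<beta>. exp (- s * (x $ 1 - a)\<^sup>2) * exp (- s * (x $ 2 - \<beta>)\<^sup>2)"])
       (auto intro!: derivative_eq_intros continuous_intros gaussian_dipole_continuous
         simp: gaussian_dipole_def algebra_simps continuous_on_eq_continuous_at[symmetric])
  have "continuous_on UNIV (\<lambda>z. gaussian_dipole s (fst z) (a, snd z))"
    by (intro gaussian_dipole_continuous continuous_intros)
  from borel_measurable_continuous_onI[OF this]
  have m: "(\<lambda>z. gaussian_dipole s (fst z) (a, snd z)) \<in> borel_measurable (\<mu> \<Otimes>\<^sub>M lborel)"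
    by (simp only: measurable_cong_sets[OF sets_pair_measure_cong[OF \<mu>(2) sets_lborel] refl] borel_prod)
  have I: "integrable (\<mu> \<Otimes>\<^sub>M lborel) (case_prod ?g)"
  proof (rule Bochner_Integration.integrable_bound)
    have "has_bochner_integral \<mu> (\<lambda>_. 2 * s * (1 + 1 / s)) (measure \<mu> (space \<mu>) *\<^sub>R (2 * s * (1 + 1 / s)))"
      by (simp add: has_bochner_integral_iff)
    from has_bochner_integral_pair_mult[OF \<mu>.sigma_finite_measure_axioms lborel.sigma_finite_measure_axioms this
        has_bochner_integral_integrable[OF integrable_real_indicator[of "{b..b'}" lborel]]]
    show "integrable (\<mu> \<Otimes>\<^sub>M lborel) (\<lambda>(x, \<beta>). 2 * s * (1 + 1 / s) * indicator {b..b'} \<beta>)"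
      using b by (simp add: has_bochner_integral_iff)
    show "case_prod ?g \<in> borel_measurable (\<mu> \<Otimes>\<^sub>M lborel)"
      unfolding split_beta' by (intro borel_measurable_times m) auto
    show "AE z in \<mu> \<Otimes>\<^sub>M lborel. norm (case_prod ?g z)
        \<le> norm (case z of (x, \<beta>) \<Rightarrow> 2 * s * (1 + 1 / s) * indicator {b..b'} \<beta>)"
      using gaussian_dipole_bounded[OF s] s
      by (intro AE_I2) (auto simp: abs_mult split: split_indicator)
  qed
  have "gaussian_transform s \<mu> a b' - gaussian_transform s \<mu> a b = (\<integral>x. (\<integral>\<beta>. ?g x \<beta> \<partial>lborel) \<partial>\<mu>)"
    unfolding gaussian_transform_def ftc
    by (rule Bochner_Integration.integral_diff[symmetric]) (intro gaussian_transform_integrable \<mu> s)+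
  also have "\<dots> = (\<integral>\<beta>. (\<integral>x. ?g x \<beta> \<partial>\<mu>) \<partial>lborel)"
    by (rule P.Fubini_integral[OF I, symmetric])
  finally show ?thesis by (simp add: dipole_transform_def)
qed

lemma gaussian_transform_tendsto_0:
  assumes \<mu>: "finite_measure \<mu>" "sets \<mu> = sets borel" and s: "0 < s"
  shows "(\<lambda>n. gaussian_transform s \<mu> a (- real n)) \<longlonglongrightarrow> 0"
proof -
  interpret finite_measure \<mu> by fact
  have "(\<lambda>n. gaussian_transform s \<mu> a (- real n)) \<longlonglongrightarrow> (\<integral>x. 0 \<partial>\<mu>)"
    unfolding gaussian_transform_def
  proof (rule integral_dominated_convergence[where w="\<lambda>_. 1"])
    show "AE x in \<mu>. (\<lambda>n. exp (- s * (x $ 1 - a)\<^sup>2) * exp (- s * (x $ 2 - - real n)\<^sup>2)) \<longlonglongrightarrow> 0"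
    proof (intro AE_I2 tendsto_mult_right_zero)
      fix x :: "real^2"
      define c where "c = x $ 2"
      show "(\<lambda>n. exp (- s * (x $ 2 - - real n)\<^sup>2)) \<longlonglongrightarrow> 0"
        unfolding c_def[symmetric] using s by real_asymp
    qed
    show "AE x in \<mu>. norm (exp (- s * (x $ 1 - a)\<^sup>2) * exp (- s * (x $ 2 - - real n)\<^sup>2)) \<le> 1" for n
      using gaussian_product_le_1[OF s] by (intro AE_I2) (simp only: abs_mult abs_exp_cancel real_norm_def)
    show "(\<lambda>x. exp (- s * (x $ 1 - a)\<^sup>2) * exp (- s * (x $ 2 - - real n)\<^sup>2)) \<in> borel_measurable \<mu>" for n
      by (rule borel_measurable_integrable[OF gaussian_transform_integrable[OF \<mu> s]])
  qed auto
  then show ?thesis by simp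
qed

text \<open>
  The Gaussian transforms of the two measures differ by a function that is constant along vertical
  lines and tends to zero along them, so they agree. Expanding the square in the exponent, the Gaussian
  transform is, up to a nonzero factor, the Laplace transform of \<open>exp (- s * |x|\<^sup>2)\<close> times the measure.
\<close>
lemma dipole_transform_injective:
  assumes \<mu>: "finite_measure \<mu>" "sets \<mu> = sets borel" "AE x in \<mu>. x \<in> K"
    and \<nu>: "finite_measure \<nu>" "sets \<nu> = sets borel" "AE x in \<nu>. x \<in> K"
    and K: "compact K" and s: "0 < s"
    and eq: "\<And>\<omega>. dipole_transform s \<mu> \<omega> = dipole_transform s \<nu> \<omega>"
  shows "\<mu> = \<nu>"
proof -
  have const: "gaussian_transform s \<mu> a b' - gaussian_transform s \<nu> a b'
      = gaussian_transform s \<mu> a b - gaussian_transform s \<nu> a b" if "b \<le> b'" for a b b'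
    using gaussian_transform_diff[OF \<mu>(1,2) s that, of a] gaussian_transform_diff[OF \<nu>(1,2) s that, of a]
    by (simp add: eq)
  have G: "gaussian_transform s \<mu> a b = gaussian_transform s \<nu> a b" for a b
  proof -
    have "(\<lambda>n. gaussian_transform s \<mu> a (- real n) - gaussian_transform s \<nu> a (- real n)) \<longlonglongrightarrow> 0 - 0"
      by (intro tendsto_diff gaussian_transform_tendsto_0 \<mu> \<nu> s)
    moreover have "\<forall>\<^sub>F n in sequentially. gaussian_transform s \<mu> a (- real n) - gaussian_transform s \<nu> a (- real n)
        = gaussian_transform s \<mu> a b - gaussian_transform s \<nu> a b"
    proof -
      obtain N :: nat where "- b \<le> real N" using real_arch_simple by blast
      then have "- real n \<le> b" if "N \<le> n" for n using that by (smt (verit) of_nat_mono)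
      then show ?thesis unfolding eventually_sequentially using const[of "- real _" b a] by metis
    qed
    then have "(\<lambda>n. gaussian_transform s \<mu> a (- real n) - gaussian_transform s \<nu> a (- real n))
        \<longlonglongrightarrow> gaussian_transform s \<mu> a b - gaussian_transform s \<nu> a b"
      by (rule tendsto_eventually)
    ultimately show ?thesis using LIMSEQ_unique by fastforce
  qed
  show ?thesis
  proof (rule measure_eqI_laplace_transform[OF \<mu> \<nu> K, where q="\<lambda>x. exp (- s * (norm x)\<^sup>2)"])
    fix z :: "real^2"
    \<comment> \<open>the centre at which the cross term of the Gaussian exponent is \<open>z \<bullet> x\<close>\<close>
    define a b where "a = z $ 1 / (2 * s)" and "b = z $ 2 / (2 * s)"
    have "exp (- s * (norm x)\<^sup>2) * exp (z \<bullet> x)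
        = exp (s * (a\<^sup>2 + b\<^sup>2)) * (exp (- s * (x $ 1 - a)\<^sup>2) * exp (- s * (x $ 2 - b)\<^sup>2))" for x
    proof -
      have "z \<bullet> x = 2 * s * a * x $ 1 + 2 * s * b * x $ 2"
        using s by (simp add: inner_vec_def sum_2 a_def b_def)
      then have "- s * (norm x)\<^sup>2 + z \<bullet> x
          = s * (a\<^sup>2 + b\<^sup>2) + (- s * (x $ 1 - a)\<^sup>2 + - s * (x $ 2 - b)\<^sup>2)"
        unfolding norm_real2_squared by (simp add: power2_eq_square algebra_simps)
      then show ?thesis by (simp only: exp_add[symmetric])
    qed
    then have "(\<integral>x. exp (- s * (norm x)\<^sup>2) * exp (z \<bullet> x) \<partial>L) = exp (s * (a\<^sup>2 + b\<^sup>2)) * gaussian_transform s L a b" for L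
      by (simp add: gaussian_transform_def)
    then show "(\<integral>x. exp (- s * (norm x)\<^sup>2) * exp (z \<bullet> x) \<partial>\<mu>) = (\<integral>x. exp (- s * (norm x)\<^sup>2) * exp (z \<bullet> x) \<partial>\<nu>)"
      by (simp add: G)
  qed (auto intro!: continuous_intros)
qed

text \<open>
  By continuity the set of equality is closed, and a closed set of full Lebesgue measure is the whole
  space.
\<close>
lemma dipole_transform_eq_if_AE:
  assumes \<mu>: "finite_measure \<mu>" "sets \<mu> = sets borel"
    and \<nu>: "finite_measure \<nu>" "sets \<nu> = sets borel" and s: "0 < s"
    and eq: "AE \<omega> in lborel. dipole_transform s \<mu> \<omega> = dipole_transform s \<nu> \<omega>"
  shows "dipole_transform s \<mu> \<omega> = dipole_transform s \<nu> \<omega>"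
proof -
  have "closed {\<omega>. dipole_transform s \<mu> \<omega> = dipole_transform s \<nu> \<omega>}"
    by (intro closed_Collect_eq dipole_transform_continuous \<mu> \<nu> s)
  from mem_closed_if_AE_lebesgue[OF this, of \<omega>] AE_completion[OF eq] show ?thesis by simp
qed

section \<open>Decomposition of the potential into scales\<close>

text \<open>
  The contribution of the scale \<open>t\<close> to \<open>ln R - ln |x|\<close>. Subtracting \<open>exp (- t * R\<^sup>2)\<close> makes it
  integrable near \<open>t = 0\<close> and nonnegative for \<open>|x| \<le> R\<close>.
\<close>
definition log_slice :: "real \<Rightarrow> real \<Rightarrow> real^2 \<Rightarrow> real" where
  "log_slice R t x = 1 / 2 * ((exp (- t * (norm x)\<^sup>2) - exp (- t * R\<^sup>2)) / t)"

text \<open>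
  The contribution of the scale \<open>t\<close> to \<open>x\<^sub>2\<^sup>2 / |x|\<^sup>2 = 1 - x\<^sub>1\<^sup>2 / |x|\<^sup>2\<close>.
\<close>
definition aniso_slice :: "real \<Rightarrow> real^2 \<Rightarrow> real" where
  "aniso_slice t x = (x $ 2)\<^sup>2 * exp (- t * (norm x)\<^sup>2)"

lemma log_slice_minus_aniso_slice:
  "0 < t \<Longrightarrow> log_slice R t x - aniso_slice t x = scale_kernel t x - exp (- t * R\<^sup>2) / (2 * t)"
  by (simp add: log_slice_def aniso_slice_def scale_kernel_def field_simps)

lemma nn_integral_aniso_slice:
  "(\<integral>\<^sup>+t. ennreal (aniso_slice t x) * indicator {0<..} t \<partial>lborel) = ennreal ((x $ 2)\<^sup>2 / (norm x)\<^sup>2)"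
proof (cases "x = 0")
  case False
  have "(\<integral>\<^sup>+t. ennreal (aniso_slice t x) * indicator {0<..} t \<partial>lborel)
      = (\<integral>\<^sup>+t. ennreal ((x $ 2)\<^sup>2) * (ennreal (exp (- t * (norm x)\<^sup>2)) * indicator {0<..} t) \<partial>lborel)"
    by (simp add: aniso_slice_def ennreal_mult mult.assoc)
  also have "\<dots> = ennreal ((x $ 2)\<^sup>2) * ennreal (1 / (norm x)\<^sup>2)"
    using nn_integral_exp_decay[of "(norm x)\<^sup>2"] False by (simp add: nn_integral_cmult)
  finally show ?thesis by (simp add: ennreal_mult[symmetric])
qed (simp add: aniso_slice_def)

lemma real2_component_le_norm: "((x :: real^2) $ 2)\<^sup>2 / (norm x)\<^sup>2 \<le> 1"
proof -
  have "(x $ 2)\<^sup>2 \<le> (norm x)\<^sup>2" by (simp add: norm_real2_squared)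
  then show ?thesis by (cases "x = 0") (simp_all add: divide_le_eq_1)
qed

lemma nn_integral_log_slice:
  assumes "0 < R" "norm x \<le> R" "x \<noteq> 0"
  shows "(\<integral>\<^sup>+t. ennreal (log_slice R t x) * indicator {0<..} t \<partial>lborel) = ennreal (ln R - ln (norm x))"
proof -
  have x: "0 < norm x" using assms by simp
  have "(\<integral>\<^sup>+t. ennreal (log_slice R t x) * indicator {0<..} t \<partial>lborel)
      = (\<integral>\<^sup>+t. ennreal (1 / 2) * (ennreal ((exp (- t * (norm x)\<^sup>2) - exp (- t * R\<^sup>2)) / t) * indicator {0<..} t) \<partial>lborel)"
    unfolding log_slice_def by (simp only: ennreal_mult'' ennreal_mult' mult.assoc)
  also have "\<dots> = ennreal (1 / 2) * ennreal (ln (R\<^sup>2 / (norm x)\<^sup>2))"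
    using x frullani_exp[OF _ power_mono[OF assms(2) norm_ge_zero], of 2]
    by (simp add: nn_integral_cmult)
  also have "\<dots> = ennreal (1 / 2 * ln (R\<^sup>2 / (norm x)\<^sup>2))"
    by (rule ennreal_mult'[symmetric]) simp
  also have "1 / 2 * ln (R\<^sup>2 / (norm x)\<^sup>2) = ln R - ln (norm x)"
  proof -
    have "ln (R\<^sup>2 / (norm x)\<^sup>2) = ln ((R / norm x) ^ 2)"
      by (simp only: power_divide)
    also have "\<dots> = 2 * (ln R - ln (norm x))"
      using assms(1) x by (simp add: ln_realpow ln_div)
    finally show ?thesis by simp
  qed
  finally show ?thesis .
qed

lemma nn_integral_log_slice_0:
  assumes "0 < R"
  shows "(\<integral>\<^sup>+t. ennreal (log_slice R t 0) * indicator {0<..} t \<partial>lborel) = \<infinity>"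
proof -
  have slice0: "log_slice R t 0 = 1 / 2 * ((1 - exp (- t * R\<^sup>2)) / t)" for t
    by (simp add: log_slice_def)
  have "(\<integral>\<^sup>+t. ennreal (log_slice R t 0) * indicator {0<..} t \<partial>lborel)
      = (\<integral>\<^sup>+t. ennreal (1 / 2) * (ennreal ((1 - exp (- t * R\<^sup>2)) / t) * indicator {0<..} t) \<partial>lborel)"
    unfolding slice0 by (simp only: ennreal_mult'' ennreal_mult' mult.assoc)
  also have "\<dots> = ennreal (1 / 2) * \<infinity>"
    using frullani_exp_zero[of "R\<^sup>2"] assms by (simp add: nn_integral_cmult)
  finally show ?thesis by (simp add: ennreal_mult_top)
qed

text \<open>
  Adding \<open>ln R\<close> makes the potential nonnegative on the ball of radius \<open>R\<close>.
\<close>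
definition shifted_V :: "real \<Rightarrow> real^2 \<Rightarrow> ennreal" where
  "shifted_V R x = e2ennreal (V x + ereal (ln R))"

lemma shifted_V_0: "shifted_V R 0 = \<infinity>"
  unfolding shifted_V_def V_def by simp

text \<open>
  The anisotropic slices enter \<open>V\<close> with a negative sign; they stand on the left so that all terms
  are nonnegative. At the origin both sides are infinite.
\<close>
lemma shifted_V_slices:
  assumes "0 < R" "norm x \<le> R"
  shows "shifted_V R x + (\<integral>\<^sup>+t. ennreal (aniso_slice t x) * indicator {0<..} t \<partial>lborel)
    = (\<integral>\<^sup>+t. ennreal (log_slice R t x) * indicator {0<..} t \<partial>lborel) + 1"
proof (cases "x = 0")
  case True
  then show ?thesis
    by (simp only: shifted_V_0 nn_integral_log_slice_0[OF assms(1)] infinity_ennreal_def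
        add_top_right_ennreal add_top_left_ennreal)
next
  case False
  then have x: "0 < norm x" by simp
  have ln: "ln (norm x) \<le> ln R" using assms x by (subst ln_le_cancel_iff)
  have split: "(x $ 1)\<^sup>2 / (norm x)\<^sup>2 + (x $ 2)\<^sup>2 / (norm x)\<^sup>2 = 1"
    using x by (simp add: norm_real2_squared[symmetric] add_divide_distrib[symmetric])
  have "shifted_V R x + ennreal ((x $ 2)\<^sup>2 / (norm x)\<^sup>2)
      = ennreal (- ln (norm x) + (x $ 1)\<^sup>2 / (norm x)\<^sup>2 + ln R) + ennreal ((x $ 2)\<^sup>2 / (norm x)\<^sup>2)"
    using False by (simp add: shifted_V_def V_def)
  also have "\<dots> = ennreal (- ln (norm x) + (x $ 1)\<^sup>2 / (norm x)\<^sup>2 + ln R + (x $ 2)\<^sup>2 / (norm x)\<^sup>2)"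
  proof (rule ennreal_plus[symmetric])
    have "0 \<le> (x $ 1)\<^sup>2 / (norm x)\<^sup>2" by simp
    with ln show "0 \<le> - ln (norm x) + (x $ 1)\<^sup>2 / (norm x)\<^sup>2 + ln R" by linarith
  qed simp
  also have "- ln (norm x) + (x $ 1)\<^sup>2 / (norm x)\<^sup>2 + ln R + (x $ 2)\<^sup>2 / (norm x)\<^sup>2 = (ln R - ln (norm x)) + 1"
    using split by linarith
  also have "ennreal \<dots> = ennreal (ln R - ln (norm x)) + 1"
    using ln by (subst ennreal_plus) auto
  finally show ?thesis
    unfolding nn_integral_aniso_slice nn_integral_log_slice[OF assms False] .
qed

lemma V_measurable[measurable]: "V \<in> borel_measurable borel"
proof -
  have c1: "(\<lambda>x::real^2. (x $ 1)\<^sup>2) \<in> borel_measurable borel"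
    and c2: "(\<lambda>x::real^2. (norm x)\<^sup>2) \<in> borel_measurable borel"
    and c3: "(\<lambda>x::real^2. norm x) \<in> borel_measurable borel"
    by (intro borel_measurable_continuous_onI continuous_intros)+
  have "(\<lambda>x::real^2. - ln (norm x) + (x $ 1)\<^sup>2 / (norm x)\<^sup>2) \<in> borel_measurable borel"
    by (rule borel_measurable_add[OF borel_measurable_uminus[OF borel_measurable_ln[OF c3]] borel_measurable_divide[OF c1 c2]])
  from borel_measurable_ereal[OF this] show ?thesis
    unfolding V_def[abs_def] by (intro measurable_If measurable_const) (simp_all add: pred_def)
qed

lemma shifted_V_measurable[measurable]: "shifted_V R \<in> borel_measurable borel"
  unfolding shifted_V_def[abs_def] by measurable

lemma slice_measurable:
  "(\<lambda>(t, x). log_slice R t x) \<in> borel_measurable borel"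
  "(\<lambda>(t, x). aniso_slice t x) \<in> borel_measurable borel"
proof -
  have num: "(\<lambda>z::real \<times> (real^2). exp (- fst z * (norm (snd z))\<^sup>2) - exp (- fst z * R\<^sup>2)) \<in> borel_measurable borel"
    and den: "(\<lambda>z::real \<times> (real^2). fst z) \<in> borel_measurable borel"
    by (intro borel_measurable_continuous_onI continuous_intros)+
  show "(\<lambda>(t, x). log_slice R t x) \<in> borel_measurable borel"
    unfolding log_slice_def split_beta'
    by (rule borel_measurable_times[OF borel_measurable_const borel_measurable_divide[OF num den]])
  show "(\<lambda>(t, x). aniso_slice t x) \<in> borel_measurable borel"
    unfolding aniso_slice_def split_beta' by (intro borel_measurable_continuous_onI continuous_intros)
qed

lemma V_lower_bound:
  assumes "norm x \<le> R" "0 < R"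
  shows "- ereal (ln R) \<le> V x"
proof (cases "x = 0")
  case False
  then have "ln (norm x) \<le> ln R" using assms by (subst ln_le_cancel_iff) auto
  moreover have "0 \<le> (x $ 1)\<^sup>2 / (norm x)\<^sup>2" by simp
  ultimately have "- ln R \<le> - ln (norm x) + (x $ 1)\<^sup>2 / (norm x)\<^sup>2" by linarith
  then show ?thesis using False by (simp add: V_def)
qed (simp add: V_def)

section \<open>Interaction energies as integrals of nonnegative functions\<close>

text \<open>
  Adding the negative part to both sides turns the splitting of \<open>y\<close> into an identity between
  nonnegative quantities that can be integrated term by term.
\<close>
lemma e2ennreal_shift:
  fixes y :: ereal
  assumes "0 \<le> c" "- ereal c \<le> y"
  shows "e2ennreal (y + ereal c) + e2ennreal (max 0 (- y)) = e2ennreal (max 0 y) + ennreal c"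
proof (cases y)
  case (real r)
  then have "- c \<le> r" using assms by simp
  then show ?thesis using real assms
    by (cases "0 \<le> r") (auto simp: max_def ennreal_plus[symmetric] simp del: ennreal_plus)
qed (use assms in \<open>auto simp: max_def\<close>)

lemma ereal_integral_shift:
  assumes "prob_space M" and f[measurable]: "f \<in> borel_measurable M"
    and c: "0 \<le> c" and low: "AE x in M. - ereal c \<le> f x"
  shows "ereal_integral M f = enn2ereal (\<integral>\<^sup>+x. e2ennreal (f x + ereal c) \<partial>M) - ereal c"
proof -
  interpret prob_space M by fact
  define I P N where "I = (\<integral>\<^sup>+x. e2ennreal (f x + ereal c) \<partial>M)"
    and "P = (\<integral>\<^sup>+x. e2ennreal (max 0 (f x)) \<partial>M)" and "N = (\<integral>\<^sup>+x. e2ennreal (max 0 (- f x)) \<partial>M)"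
  have "I + N = (\<integral>\<^sup>+x. e2ennreal (f x + ereal c) + e2ennreal (max 0 (- f x)) \<partial>M)"
    unfolding I_def N_def by (rule nn_integral_add[symmetric]) measurable
  also have "\<dots> = (\<integral>\<^sup>+x. e2ennreal (max 0 (f x)) + ennreal c \<partial>M)"
    using low by (intro nn_integral_cong_AE) (auto simp: e2ennreal_shift[OF c])
  also have "\<dots> = P + ennreal c"
    unfolding P_def by (subst nn_integral_add) (auto simp: emeasure_space_1)
  finally have eq: "I + N = P + ennreal c" .
  have "N \<le> (\<integral>\<^sup>+x. ennreal c \<partial>M)"
    unfolding N_def
  proof (rule nn_integral_mono_AE)
    show "AE x in M. e2ennreal (max 0 (- f x)) \<le> ennreal c"
      using low
    proof eventually_elim
      case (elim x)
      then have "max 0 (- f x) \<le> ereal c" using c by (auto simp: ereal_uminus_le_reorder)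
      then show ?case using e2ennreal_mono by fastforce
    qed
  qed
  then have "N \<le> ennreal c" by (simp add: emeasure_space_1)
  then have "N < top" using ennreal_less_top le_less_trans by blast
  then obtain n where n: "N = ennreal n" "0 \<le> n" by (cases N) auto
  have "enn2ereal P - enn2ereal N = enn2ereal I - ereal c"
  proof (cases P)
    case (real p)
    have "P + ennreal c < top" using real by simp
    then have "I < top" unfolding eq[symmetric] by (simp add: less_top[symmetric])
    then obtain i where i: "I = ennreal i" "0 \<le> i" by (cases I) auto
    then have "i + n = p + c" using eq n real c by (simp add: ennreal_plus[symmetric] del: ennreal_plus)
    then show ?thesis using i n real by (simp add: enn2ereal_ennreal)
  next
    case top
    then have "I = top" using eq n by (cases I) (auto simp: ennreal_plus[symmetric] simp del: ennreal_plus)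
    then show ?thesis using top n by (simp add: enn2ereal_ennreal)
  qed
  then show ?thesis by (simp add: ereal_integral_def I_def P_def N_def)
qed

text \<open>
  On the supports \<open>V\<close> is bounded below by \<open>- ln R\<close>, so both iterated integrals can be shifted to
  integrals of nonnegative functions, where Tonelli turns them into one integral over the product.
\<close>
lemma interaction_eq_nn_integral:
  assumes \<mu>: "prob_space \<mu>" "sets \<mu> = sets borel" "AE x in \<mu>. x \<in> K"
    and \<nu>: "prob_space \<nu>" "sets \<nu> = sets borel" "AE x in \<nu>. x \<in> K"
    and R: "1 \<le> R" and K: "\<And>x y. x \<in> K \<Longrightarrow> y \<in> K \<Longrightarrow> norm (x - y) \<le> R"
  shows "interaction \<mu> \<nu> = enn2ereal (\<integral>\<^sup>+z. shifted_V R (fst z - snd z) \<partial>(\<nu> \<Otimes>\<^sub>M \<mu>)) - ereal (ln R)"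
proof -
  interpret \<mu>: prob_space \<mu> by fact
  interpret \<nu>: prob_space \<nu> by fact
  note [measurable_cong] = \<mu>(2) \<nu>(2)
  have c: "0 \<le> ln R" using R by simp
  have conv: "V_conv \<mu> x = enn2ereal (\<integral>\<^sup>+y. shifted_V R (x - y) \<partial>\<mu>) - ereal (ln R)" if "x \<in> K" for x
    unfolding V_conv_def shifted_V_def
  proof (rule ereal_integral_shift[OF \<mu>(1) _ c])
    show "AE y in \<mu>. - ereal (ln R) \<le> V (x - y)"
      using \<mu>(3) by eventually_elim (use V_lower_bound K that R in simp)
  qed measurable
  have "V_conv \<mu> \<in> borel_measurable \<nu>"
    unfolding V_conv_def[abs_def] ereal_integral_def by measurable
  then have "interaction \<mu> \<nu> = enn2ereal (\<integral>\<^sup>+x. e2ennreal (V_conv \<mu> x + ereal (ln R)) \<partial>\<nu>) - ereal (ln R)"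
    unfolding interaction_def
  proof (rule ereal_integral_shift[OF \<nu>(1) _ c])
    show "AE x in \<nu>. - ereal (ln R) \<le> V_conv \<mu> x"
      using \<nu>(3)
    proof eventually_elim
      case (elim x)
      show ?case unfolding conv[OF elim]
        using enn2ereal_nonneg[of "\<integral>\<^sup>+y. shifted_V R (x - y) \<partial>\<mu>"]
        by (cases "enn2ereal (\<integral>\<^sup>+y. shifted_V R (x - y) \<partial>\<mu>)") auto
    qed
  qed
  also have "(\<integral>\<^sup>+x. e2ennreal (V_conv \<mu> x + ereal (ln R)) \<partial>\<nu>) = (\<integral>\<^sup>+x. \<integral>\<^sup>+y. shifted_V R (x - y) \<partial>\<mu> \<partial>\<nu>)"
  proof (rule nn_integral_cong_AE)
    show "AE x in \<nu>. e2ennreal (V_conv \<mu> x + ereal (ln R)) = (\<integral>\<^sup>+y. shifted_V R (x - y) \<partial>\<mu>)"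
      using \<nu>(3)
    proof eventually_elim
    case (elim x)
    have "enn2ereal (\<integral>\<^sup>+y. shifted_V R (x - y) \<partial>\<mu>) - ereal (ln R) + ereal (ln R) = enn2ereal (\<integral>\<^sup>+y. shifted_V R (x - y) \<partial>\<mu>)"
      by (cases "enn2ereal (\<integral>\<^sup>+y. shifted_V R (x - y) \<partial>\<mu>)") auto
    then show ?case unfolding conv[OF elim] by simp
    qed
  qed
  also have "\<dots> = (\<integral>\<^sup>+z. shifted_V R (fst z - snd z) \<partial>(\<nu> \<Otimes>\<^sub>M \<mu>))"
    by (subst \<mu>.nn_integral_fst[symmetric]) simp_all
  finally show ?thesis .
qed

text \<open>
  The complement of the support is covered by null sets taken from a countable basis.
\<close>
lemma AE_topological_support:
  assumes "sets \<mu> = sets borel"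
  shows "AE x in \<mu>. x \<in> topological_support \<mu>"
proof -
  obtain \<B> :: "(real^2) set set" where \<B>: "countable \<B>" "topological_basis \<B>"
    using ex_countable_basis by blast
  let ?B = "{B \<in> \<B>. emeasure \<mu> B = 0}"
  have "AE x in \<mu>. \<forall>B\<in>?B. x \<notin> B"
  proof (subst AE_ball_countable)
    show "countable ?B" using \<B>(1) by (rule countable_subset[rotated]) auto
    show "\<forall>B\<in>?B. AE x in \<mu>. x \<notin> B"
    proof
      fix B assume "B \<in> ?B"
      then have "B \<in> null_sets \<mu>"
        using assms topological_basis_open[OF \<B>(2)] by auto
      then show "AE x in \<mu>. x \<notin> B" by (rule AE_not_in)
    qed
  qed
  then show ?thesis
  proof eventually_elim
    case (elim x)
    show ?case unfolding topological_support_def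
    proof (safe)
      fix U assume U: "open U" "x \<in> U"
      obtain B where B: "B \<in> \<B>" "x \<in> B" "B \<subseteq> U"
        by (rule topological_basisE[OF \<B>(2) U])
      then have "emeasure \<mu> B \<noteq> 0" using elim by blast
      moreover have "emeasure \<mu> B \<le> emeasure \<mu> U" using B U assms by (intro emeasure_mono) simp_all
      ultimately show "emeasure \<mu> U > 0" by (auto simp: zero_less_iff_neq_zero)
    qed
  qed
qed

section \<open>Decomposition of the energy into scales\<close>

definition mean_log_slice :: "real \<Rightarrow> ((real^2) \<times> (real^2)) measure \<Rightarrow> real \<Rightarrow> real" where
  "mean_log_slice R P t = (\<integral>z. log_slice R t (fst z - snd z) \<partial>P)"

definition mean_aniso_slice :: "((real^2) \<times> (real^2)) measure \<Rightarrow> real \<Rightarrow> real" where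
  "mean_aniso_slice P t = (\<integral>z. aniso_slice t (fst z - snd z) \<partial>P)"

lemma difference_measurable:
  assumes "sets P = sets (borel :: ((real^2) \<times> (real^2)) measure)"
  shows "(\<lambda>w. (snd w, fst (fst w) - snd (fst w))) \<in> measurable (P \<Otimes>\<^sub>M lborel) (borel :: (real \<times> (real^2)) measure)"
proof -
  have "(\<lambda>w::((real^2) \<times> (real^2)) \<times> real. (snd w, fst (fst w) - snd (fst w))) \<in> borel_measurable borel"
    by (intro borel_measurable_continuous_onI continuous_intros)
  then show ?thesis
    by (simp only: measurable_cong_sets[OF sets_pair_measure_cong[OF assms sets_lborel] refl] borel_prod)
qed

lemma slice_difference_measurable:
  assumes "sets P = sets (borel :: ((real^2) \<times> (real^2)) measure)"
  shows "(\<lambda>(z, t). log_slice R t (fst z - snd z)) \<in> borel_measurable (P \<Otimes>\<^sub>M lborel)"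
    and "(\<lambda>(z, t). aniso_slice t (fst z - snd z)) \<in> borel_measurable (P \<Otimes>\<^sub>M lborel)"
  using measurable_compose[OF difference_measurable[OF assms] slice_measurable(1)]
    measurable_compose[OF difference_measurable[OF assms] slice_measurable(2)]
  by (simp_all add: split_beta')

lemma aniso_slice_bounds:
  assumes "0 < t"
  shows "0 \<le> aniso_slice t x" "aniso_slice t x \<le> 1 / t"
proof -
  show "0 \<le> aniso_slice t x" by (simp add: aniso_slice_def)
  have "(x $ 2)\<^sup>2 \<le> (norm x)\<^sup>2" by (simp add: norm_real2_squared)
  also have "\<dots> = 1 / t * (t * (norm x)\<^sup>2)" using assms by simp
  also have "\<dots> \<le> 1 / t * exp (t * (norm x)\<^sup>2)"
  proof (rule mult_left_mono)
    show "t * (norm x)\<^sup>2 \<le> exp (t * (norm x)\<^sup>2)"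
      using exp_ge_add_one_self[of "t * (norm x)\<^sup>2"] by linarith
  qed (use assms in simp)
  finally have "(x $ 2)\<^sup>2 * exp (- (t * (norm x)\<^sup>2)) \<le> 1 / t * exp (t * (norm x)\<^sup>2) * exp (- (t * (norm x)\<^sup>2))"
    by (rule mult_right_mono) simp
  then show "aniso_slice t x \<le> 1 / t"
    by (simp add: aniso_slice_def exp_minus)
qed

lemma log_slice_nonneg:
  assumes "0 < t" "norm x \<le> R"
  shows "0 \<le> log_slice R t x"
  using assms power_mono[OF assms(2) norm_ge_zero, of 2] by (simp add: log_slice_def)

lemma log_slice_bounded:
  assumes "0 < t"
  shows "\<bar>log_slice R t x\<bar> \<le> 1 / t"
proof -
  have "exp (- t * (norm x)\<^sup>2) \<le> 1" "exp (- t * R\<^sup>2) \<le> 1" using assms by simp_all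
  then have "\<bar>exp (- t * (norm x)\<^sup>2) - exp (- t * R\<^sup>2)\<bar> \<le> 1"
    using exp_ge_zero[of "- t * (norm x)\<^sup>2"] exp_ge_zero[of "- t * R\<^sup>2"] by linarith
  then have "\<bar>exp (- t * (norm x)\<^sup>2) - exp (- t * R\<^sup>2)\<bar> / t \<le> 1 / t"
    using assms by (intro divide_right_mono) simp_all
  moreover have "0 \<le> \<bar>exp (- t * (norm x)\<^sup>2) - exp (- t * R\<^sup>2)\<bar> / t" using assms by simp
  moreover have "\<bar>log_slice R t x\<bar> = 1 / 2 * (\<bar>exp (- t * (norm x)\<^sup>2) - exp (- t * R\<^sup>2)\<bar> / t)"
    using assms by (simp add: log_slice_def abs_mult)
  ultimately show ?thesis by linarith
qed

text \<open>
  Laws of pairs of points at distance at most \<open>R\<close>, with \<open>ln R\<close> nonnegative. The three products formed from two given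
  measures are instances; the scale decomposition depends on the law of the pair only.
\<close>
locale concentrated_pairs = prob_space P for P :: "((real^2) \<times> (real^2)) measure" +
  fixes R :: real
  assumes R: "1 \<le> R" and sets_P: "sets P = sets borel"
    and close: "AE z in P. norm (fst z - snd z) \<le> R"
begin

lemma slices_integrable:
  assumes "0 < t"
  shows "integrable P (\<lambda>z. log_slice R t (fst z - snd z))" "integrable P (\<lambda>z. aniso_slice t (fst z - snd z))"
proof -
  have m: "(\<lambda>z::(real^2) \<times> (real^2). (t, fst z - snd z)) \<in> measurable P borel"
    by (simp only: measurable_cong_sets[OF sets_P refl])
      (intro borel_measurable_continuous_onI continuous_intros)
  show "integrable P (\<lambda>z. log_slice R t (fst z - snd z))"
    using log_slice_bounded[OF assms] measurable_compose[OF m slice_measurable(1)]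
    by (intro integrable_const_bound[of _ "1 / t"]) auto
  show "integrable P (\<lambda>z. aniso_slice t (fst z - snd z))"
    using aniso_slice_bounds[OF assms] measurable_compose[OF m slice_measurable(2)]
    by (intro integrable_const_bound[of _ "1 / t"]) auto
qed

lemma mean_slice_measurable:
  "mean_log_slice R P \<in> borel_measurable lborel" "mean_aniso_slice P \<in> borel_measurable lborel"
proof -
  note m = slice_difference_measurable[OF sets_P, THEN measurable_pair_swap]
  show "mean_log_slice R P \<in> borel_measurable lborel" "mean_aniso_slice P \<in> borel_measurable lborel"
    unfolding mean_log_slice_def[abs_def] mean_aniso_slice_def[abs_def]
    using borel_measurable_lebesgue_integral[of "\<lambda>t z. log_slice R t (fst z - snd z)" lborel]
      borel_measurable_lebesgue_integral[of "\<lambda>t z. aniso_slice t (fst z - snd z)" lborel] m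
    by (simp_all add: split_beta')
qed

lemma mean_slice_nonneg:
  assumes "0 < t"
  shows "0 \<le> mean_log_slice R P t" "0 \<le> mean_aniso_slice P t"
  unfolding mean_log_slice_def mean_aniso_slice_def
  using close aniso_slice_bounds[OF assms] log_slice_nonneg[OF assms]
  by (auto intro!: integral_nonneg_AE)

lemma nn_integral_swap:
  fixes h :: "real \<Rightarrow> real^2 \<Rightarrow> real"
  assumes m: "(\<lambda>(z, t). h t (fst z - snd z)) \<in> borel_measurable (P \<Otimes>\<^sub>M lborel)"
    and i: "\<And>t. 0 < t \<Longrightarrow> integrable P (\<lambda>z. h t (fst z - snd z))"
    and nn: "\<And>t. 0 < t \<Longrightarrow> AE z in P. 0 \<le> h t (fst z - snd z)"
  shows "(\<integral>\<^sup>+z. (\<integral>\<^sup>+t. ennreal (h t (fst z - snd z)) * indicator {0<..} t \<partial>lborel) \<partial>P)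
    = (\<integral>\<^sup>+t. ennreal (\<integral>z. h t (fst z - snd z) \<partial>P) * indicator {0<..} t \<partial>lborel)"
proof -
  interpret pair_sigma_finite P "lborel :: real measure" ..
  have "(\<lambda>w. ennreal ((\<lambda>(z, t). h t (fst z - snd z)) w) * indicator {0<..} (snd w)) \<in> borel_measurable (P \<Otimes>\<^sub>M lborel)"
    by (intro borel_measurable_times_ennreal measurable_compose[OF m measurable_ennreal]) measurable
  then have "(\<integral>\<^sup>+z. (\<integral>\<^sup>+t. ennreal (h t (fst z - snd z)) * indicator {0<..} t \<partial>lborel) \<partial>P)
      = (\<integral>\<^sup>+t. (\<integral>\<^sup>+z. ennreal (h t (fst z - snd z)) * indicator {0<..} t \<partial>P) \<partial>lborel)"
    by (intro Fubini'[symmetric]) (simp add: split_beta')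
  also have "\<dots> = (\<integral>\<^sup>+t. ennreal (\<integral>z. h t (fst z - snd z) \<partial>P) * indicator {0<..} t \<partial>lborel)"
  proof (rule nn_integral_cong)
    fix t :: real
    show "(\<integral>\<^sup>+z. ennreal (h t (fst z - snd z)) * indicator {0<..} t \<partial>P)
        = ennreal (\<integral>z. h t (fst z - snd z) \<partial>P) * indicator {0<..} t"
      using nn_integral_eq_integral[OF i nn, of t] by (cases "0 < t") simp_all
  qed
  finally show ?thesis .
qed

text \<open>
  The pointwise decomposition integrated over \<open>P\<close>, with the integrals over scales and pairs exchanged
  by Tonelli. The anisotropic part is at most \<open>1\<close>, which allows it to be cancelled.
\<close>
lemma mean_shifted_V:
  "(\<integral>\<^sup>+z. shifted_V R (fst z - snd z) \<partial>P)
      + (\<integral>\<^sup>+t. ennreal (mean_aniso_slice P t) * indicator {0<..} t \<partial>lborel)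
    = (\<integral>\<^sup>+t. ennreal (mean_log_slice R P t) * indicator {0<..} t \<partial>lborel) + 1" (is "?W + ?B = ?A + 1")
  and mean_aniso_slice_finite: "(\<integral>\<^sup>+t. ennreal (mean_aniso_slice P t) * indicator {0<..} t \<partial>lborel) \<noteq> top"
proof -
  let ?a = "\<lambda>z. \<integral>\<^sup>+t. ennreal (log_slice R t (fst z - snd z)) * indicator {0<..} t \<partial>lborel"
  let ?b = "\<lambda>z. \<integral>\<^sup>+t. ennreal (aniso_slice t (fst z - snd z)) * indicator {0<..} t \<partial>lborel"
  have A: "(\<integral>\<^sup>+z. ?a z \<partial>P) = ?A"
    unfolding mean_log_slice_def using log_slice_nonneg close
    by (intro nn_integral_swap slice_difference_measurable sets_P slices_integrable) auto
  have B: "(\<integral>\<^sup>+z. ?b z \<partial>P) = ?B"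
    unfolding mean_aniso_slice_def
    by (intro nn_integral_swap slice_difference_measurable sets_P slices_integrable AE_I2 aniso_slice_bounds)
  have md: "(\<lambda>z::(real^2) \<times> (real^2). fst z - snd z) \<in> measurable P borel"
    by (simp only: measurable_cong_sets[OF sets_P refl])
      (intro borel_measurable_continuous_onI continuous_intros)
  have mW: "(\<lambda>z. shifted_V R (fst z - snd z)) \<in> borel_measurable P"
    by (rule measurable_compose[OF md shifted_V_measurable])
  have ma: "?a \<in> borel_measurable P"
    by (intro lborel.borel_measurable_nn_integral) (use slice_difference_measurable(1)[OF sets_P] in \<open>simp add: split_beta'\<close>)
  have mb: "?b \<in> borel_measurable P"
    by (intro lborel.borel_measurable_nn_integral) (use slice_difference_measurable(2)[OF sets_P] in \<open>simp add: split_beta'\<close>)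
  have "?W + ?B = (\<integral>\<^sup>+z. shifted_V R (fst z - snd z) + ?b z \<partial>P)"
    unfolding B[symmetric] by (rule nn_integral_add[symmetric, OF mW mb])
  also have "\<dots> = (\<integral>\<^sup>+z. ?a z + 1 \<partial>P)"
    using close R by (intro nn_integral_cong_AE) (auto simp: shifted_V_slices)
  also have "\<dots> = ?A + 1"
    unfolding A[symmetric] using ma by (subst nn_integral_add) (simp_all add: emeasure_space_1)
  finally show "?W + ?B = ?A + 1" .
  have "?B \<le> (\<integral>\<^sup>+z. 1 \<partial>P)"
    unfolding B[symmetric] nn_integral_aniso_slice
    using real2_component_le_norm by (intro nn_integral_mono) (simp only: ennreal_le_1)
  also have "\<dots> = 1" by (simp add: emeasure_space_1)
  finally show "?B \<noteq> top" using ennreal_one_less_top by (auto simp: top_unique)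
qed

end

lemma concentrated_pairs_product:
  assumes \<mu>: "prob_space \<mu>" "sets \<mu> = sets borel" "AE x in \<mu>. x \<in> K"
    and \<nu>: "prob_space \<nu>" "sets \<nu> = sets borel" "AE x in \<nu>. x \<in> K"
    and R: "1 \<le> R" and K: "\<And>x y. x \<in> K \<Longrightarrow> y \<in> K \<Longrightarrow> norm (x - y) \<le> R"
  shows "concentrated_pairs (\<mu> \<Otimes>\<^sub>M \<nu>) R"
proof -
  interpret \<mu>: prob_space \<mu> by fact
  interpret \<nu>: prob_space \<nu> by fact
  interpret pair_prob_space \<mu> \<nu> ..
  have s: "sets (\<mu> \<Otimes>\<^sub>M \<nu>) = sets borel"
    using sets_pair_measure_cong[OF \<mu>(2) \<nu>(2)] by (simp only: borel_prod)
  show ?thesis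
  proof
    show "AE z in \<mu> \<Otimes>\<^sub>M \<nu>. norm (fst z - snd z) \<le> R"
    proof (rule AE_pair_measure)
      have "{z::(real^2) \<times> (real^2). norm (fst z - snd z) \<le> R} \<in> sets borel"
        by (intro borel_closed closed_Collect_le continuous_intros)
      then show "{z \<in> space (\<mu> \<Otimes>\<^sub>M \<nu>). norm (fst z - snd z) \<le> R} \<in> sets (\<mu> \<Otimes>\<^sub>M \<nu>)"
        using sets_eq_imp_space_eq[OF s] s by simp
      show "AE x in \<mu>. AE y in \<nu>. norm (fst (x, y) - snd (x, y)) \<le> R"
        using \<mu>(3)
      proof eventually_elim
        case (elim x)
        show ?case using \<nu>(3) by eventually_elim (use K elim in simp)
      qed
    qed
  qed (use R s in auto)
qed

text \<open>
  The bookkeeping that replaces subtraction in \<open>[0, \<infinity>]\<close>: \<open>W\<close>, \<open>A\<close>, \<open>B\<close> stand for the full, the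
  logarithmic and the anisotropic energies of the three pairs. Only the finite \<open>B\<close> terms are cancelled;
  \<open>W10\<close> and \<open>A10\<close> may be infinite.
\<close>
lemma ennreal_combine_energies:
  fixes W11 W00 W10 A11 A00 A10 B11 B00 B10 S :: ennreal
  assumes "W11 + B11 = A11 + 1" "W00 + B00 = A00 + 1" "W10 + B10 = A10 + 1"
    and "A11 + A00 + 2 * B10 = 2 * A10 + B11 + B00 + S"
    and "B11 \<noteq> top" "B00 \<noteq> top" "B10 \<noteq> top"
  shows "W11 + W00 = 2 * W10 + S"
proof -
  let ?B = "B11 + B00 + 2 * B10"
  have "?B + (W11 + W00) = (W11 + B11) + (W00 + B00) + 2 * B10" by (simp add: ac_simps)
  also have "\<dots> = (A11 + 1) + (A00 + 1) + 2 * B10" by (simp only: assms(1,2))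
  also have "\<dots> = (A11 + A00 + 2 * B10) + (1 + 1)" by (simp only: ac_simps)
  also have "\<dots> = 2 * (A10 + 1) + B11 + B00 + S"
    unfolding assms(4) distrib_left one_add_one mult_1_right by (simp only: ac_simps)
  also have "\<dots> = ?B + (2 * W10 + S)"
    unfolding assms(3)[symmetric] distrib_left by (simp only: ac_simps)
  finally show ?thesis
    using assms(5-7) by (simp add: ennreal_add_left_cancel ennreal_mult_eq_top_iff)
qed

text \<open>
  Expand the square \<open>F\<^sup>2\<close> and use the bilinear identity for each of the three terms.
\<close>
lemma dipole_energy:
  assumes \<mu>: "finite_measure \<mu>" "sets \<mu> = sets borel" and \<nu>: "finite_measure \<nu>" "sets \<nu> = sets borel"
    and t: "0 < t"
  defines "F \<equiv> \<lambda>\<omega>. dipole_transform (2 * t) \<mu> \<omega> - dipole_transform (2 * t) \<nu> \<omega>"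
  shows "integrable lborel (\<lambda>\<omega>. (F \<omega>)\<^sup>2)"
    and "(\<integral>z. scale_kernel t (fst z - snd z) \<partial>(\<mu> \<Otimes>\<^sub>M \<mu>)) + (\<integral>z. scale_kernel t (fst z - snd z) \<partial>(\<nu> \<Otimes>\<^sub>M \<nu>))
        - 2 * (\<integral>z. scale_kernel t (fst z - snd z) \<partial>(\<nu> \<Otimes>\<^sub>M \<mu>))
      = 16 * t / pi * (\<integral>\<omega>. (F \<omega>)\<^sup>2 \<partial>lborel)"
proof -
  let ?m = "dipole_transform (2 * t) \<mu>" and ?n = "dipole_transform (2 * t) \<nu>"
  note mm = scale_kernel_energy[OF \<mu> \<mu> t] and nn = scale_kernel_energy[OF \<nu> \<nu> t]
    and nm = scale_kernel_energy[OF \<nu> \<mu> t]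
  have sq: "(\<lambda>\<omega>. (F \<omega>)\<^sup>2) = (\<lambda>\<omega>. ?m \<omega> * ?m \<omega> + ?n \<omega> * ?n \<omega> - 2 * (?n \<omega> * ?m \<omega>))"
    by (simp add: F_def power2_eq_square algebra_simps)
  show "integrable lborel (\<lambda>\<omega>. (F \<omega>)\<^sup>2)"
    unfolding sq by (intro Bochner_Integration.integrable_diff Bochner_Integration.integrable_add
        integrable_mult_right mm(1) nn(1) nm(1))
  have "(\<integral>\<omega>. (F \<omega>)\<^sup>2 \<partial>lborel) = (\<integral>\<omega>. ?m \<omega> * ?m \<omega> \<partial>lborel) + (\<integral>\<omega>. ?n \<omega> * ?n \<omega> \<partial>lborel)
      - 2 * (\<integral>\<omega>. ?n \<omega> * ?m \<omega> \<partial>lborel)"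
    unfolding sq by (simp add: mm(1) nn(1) nm(1))
  then show "(\<integral>z. scale_kernel t (fst z - snd z) \<partial>(\<mu> \<Otimes>\<^sub>M \<mu>)) + (\<integral>z. scale_kernel t (fst z - snd z) \<partial>(\<nu> \<Otimes>\<^sub>M \<nu>))
        - 2 * (\<integral>z. scale_kernel t (fst z - snd z) \<partial>(\<nu> \<Otimes>\<^sub>M \<mu>))
      = 16 * t / pi * (\<integral>\<omega>. (F \<omega>)\<^sup>2 \<partial>lborel)"
    unfolding mm(2) nn(2) nm(2) by (simp only: right_diff_distrib distrib_left mult_ac)
qed

lemma (in concentrated_pairs) mean_slice_diff:
  assumes t: "0 < t"
  shows "mean_log_slice R P t - mean_aniso_slice P t
    = (\<integral>z. scale_kernel t (fst z - snd z) \<partial>P) - exp (- t * R\<^sup>2) / (2 * t)"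
proof -
  note i = slices_integrable[OF t]
  let ?c = "exp (- t * R\<^sup>2) / (2 * t)"
  have eq: "scale_kernel t x = log_slice R t x - aniso_slice t x + ?c" for x
    using log_slice_minus_aniso_slice[OF t, of R x] by linarith
  have "(\<integral>z. scale_kernel t (fst z - snd z) \<partial>P) = mean_log_slice R P t - mean_aniso_slice P t + ?c"
    unfolding eq mean_log_slice_def mean_aniso_slice_def
    using i by (simp add: prob_space)
  then show ?thesis by simp
qed

text \<open>
  The quadratic form of the kernel at scale \<open>t\<close> on the signed measure \<open>\<mu> - \<nu>\<close>.
\<close>
definition scale_energy :: "(real^2) measure \<Rightarrow> (real^2) measure \<Rightarrow> real \<Rightarrow> real" where
  "scale_energy \<mu> \<nu> t = 16 * t / pi *
    (\<integral>\<omega>. (dipole_transform (2 * t) \<mu> \<omega> - dipole_transform (2 * t) \<nu> \<omega>)\<^sup>2 \<partial>lborel)"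

lemma scale_energy_nonneg: "0 < t \<Longrightarrow> 0 \<le> scale_energy \<mu> \<nu> t"
  unfolding scale_energy_def by (intro mult_nonneg_nonneg integral_nonneg_AE) auto

text \<open>
  For three probability measures taken with the coefficients \<open>1, 1, -2\<close>, the constant
  \<open>exp (- t * R\<^sup>2) / (2 * t)\<close> cancels at each scale, and what remains is the quadratic form of the
  kernel. The terms are arranged so that both sides are sums of nonnegative functions of \<open>t\<close>, and then
  integrated over the scales.
\<close>
lemma energy_scale_decomposition:
  assumes \<mu>0: "prob_space \<mu>0" "sets \<mu>0 = sets borel" "AE x in \<mu>0. x \<in> K"
    and \<mu>1: "prob_space \<mu>1" "sets \<mu>1 = sets borel" "AE x in \<mu>1. x \<in> K"
    and R: "1 \<le> R" and K: "\<And>x y. x \<in> K \<Longrightarrow> y \<in> K \<Longrightarrow> norm (x - y) \<le> R"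
  shows scale_energy_measurable:
      "(\<lambda>t. ennreal (scale_energy \<mu>1 \<mu>0 t) * indicator {0<..} t) \<in> borel_measurable lborel"
    and "(\<integral>\<^sup>+z. shifted_V R (fst z - snd z) \<partial>(\<mu>1 \<Otimes>\<^sub>M \<mu>1)) + (\<integral>\<^sup>+z. shifted_V R (fst z - snd z) \<partial>(\<mu>0 \<Otimes>\<^sub>M \<mu>0))
      = 2 * (\<integral>\<^sup>+z. shifted_V R (fst z - snd z) \<partial>(\<mu>0 \<Otimes>\<^sub>M \<mu>1))
        + (\<integral>\<^sup>+t. ennreal (scale_energy \<mu>1 \<mu>0 t) * indicator {0<..} t \<partial>lborel)" (is ?decomposition)
proof -
  interpret \<mu>0: prob_space \<mu>0 by fact
  interpret \<mu>1: prob_space \<mu>1 by fact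
  interpret P11: concentrated_pairs "\<mu>1 \<Otimes>\<^sub>M \<mu>1" R by (rule concentrated_pairs_product[OF \<mu>1 \<mu>1 R K])
  interpret P00: concentrated_pairs "\<mu>0 \<Otimes>\<^sub>M \<mu>0" R by (rule concentrated_pairs_product[OF \<mu>0 \<mu>0 R K])
  interpret P01: concentrated_pairs "\<mu>0 \<Otimes>\<^sub>M \<mu>1" R by (rule concentrated_pairs_product[OF \<mu>0 \<mu>1 R K])
  define a11 a00 a10 where "a11 = mean_log_slice R (\<mu>1 \<Otimes>\<^sub>M \<mu>1)" and "a00 = mean_log_slice R (\<mu>0 \<Otimes>\<^sub>M \<mu>0)"
    and "a10 = mean_log_slice R (\<mu>0 \<Otimes>\<^sub>M \<mu>1)"
  define b11 b00 b10 where "b11 = mean_aniso_slice (\<mu>1 \<Otimes>\<^sub>M \<mu>1)" and "b00 = mean_aniso_slice (\<mu>0 \<Otimes>\<^sub>M \<mu>0)"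
    and "b10 = mean_aniso_slice (\<mu>0 \<Otimes>\<^sub>M \<mu>1)"
  define S where "S t = (a11 t - b11 t) + (a00 t - b00 t) - 2 * (a10 t - b10 t)" for t
  note meas[measurable] = P11.mean_slice_measurable[folded a11_def b11_def]
    P00.mean_slice_measurable[folded a00_def b00_def] P01.mean_slice_measurable[folded a10_def b10_def]
  have S_meas[measurable]: "S \<in> borel_measurable lborel"
    unfolding S_def[abs_def] by measurable
  have cancel_const: "x - y + (x' - y') - 2 * (x'' - y'') = E"
    if "k + k' - 2 * k'' = E" "x - y = k - c" "x' - y' = k' - c" "x'' - y'' = k'' - c"
    for x y x' y' x'' y'' k k' k'' c E :: real
    using that by simp
  have S_eq: "S t = scale_energy \<mu>1 \<mu>0 t" if t: "0 < t" for t
    unfolding S_def scale_energy_def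
    by (rule cancel_const[OF dipole_energy(2)[OF \<mu>1.finite_measure_axioms \<mu>1(2) \<mu>0.finite_measure_axioms \<mu>0(2) t]
      P11.mean_slice_diff[OF t, folded a11_def b11_def] P00.mean_slice_diff[OF t, folded a00_def b00_def]
      P01.mean_slice_diff[OF t, folded a10_def b10_def]])
  let ?I = "\<lambda>f. \<integral>\<^sup>+t. ennreal (f t) * indicator {0<..} t \<partial>lborel"
  have slices: "?I a11 + ?I a00 + 2 * ?I b10 = 2 * ?I a10 + ?I b11 + ?I b00 + ?I S"
  proof -
    have pos: "ennreal (a11 t) + ennreal (a00 t) + 2 * ennreal (b10 t)
        = 2 * ennreal (a10 t) + ennreal (b11 t) + ennreal (b00 t) + ennreal (S t)" if t: "0 < t" for t
    proof -
      have S0: "0 \<le> S t" unfolding S_eq[OF t] by (rule scale_energy_nonneg[OF t])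
      note n = P11.mean_slice_nonneg[OF t, folded a11_def b11_def] P00.mean_slice_nonneg[OF t, folded a00_def b00_def]
        P01.mean_slice_nonneg[OF t, folded a10_def b10_def] S0
      have two: "2 * ennreal r = ennreal (2 * r)" if "0 \<le> r" for r
        using that by (simp add: ennreal_mult)
      have "ennreal (a11 t) + ennreal (a00 t) + 2 * ennreal (b10 t) = ennreal (a11 t + a00 t + 2 * b10 t)"
        using n by (simp add: two)
      also have "a11 t + a00 t + 2 * b10 t = 2 * a10 t + b11 t + b00 t + S t"
        unfolding S_def by simp
      also have "ennreal \<dots> = 2 * ennreal (a10 t) + ennreal (b11 t) + ennreal (b00 t) + ennreal (S t)"
        using n by (simp add: two)
      finally show ?thesis .
    qed
    have "?I a11 + ?I a00 + 2 * ?I b10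
        = (\<integral>\<^sup>+t. (ennreal (a11 t) + ennreal (a00 t) + 2 * ennreal (b10 t)) * indicator {0<..} t \<partial>lborel)"
      by (simp add: nn_integral_add nn_integral_cmult distrib_right mult.assoc)
    also have "\<dots> = (\<integral>\<^sup>+t. (2 * ennreal (a10 t) + ennreal (b11 t) + ennreal (b00 t) + ennreal (S t)) * indicator {0<..} t \<partial>lborel)"
      by (intro nn_integral_cong) (auto simp: pos split: split_indicator)
    also have "\<dots> = 2 * ?I a10 + ?I b11 + ?I b00 + ?I S"
      by (simp add: nn_integral_add nn_integral_cmult distrib_right mult.assoc)
    finally show ?thesis .
  qed
  have S_fun: "(\<lambda>t. ennreal (scale_energy \<mu>1 \<mu>0 t) * indicator {0<..} t) = (\<lambda>t. ennreal (S t) * indicator {0<..} t)"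
    by (auto simp: fun_eq_iff S_eq split: split_indicator)
  show "(\<lambda>t. ennreal (scale_energy \<mu>1 \<mu>0 t) * indicator {0<..} t) \<in> borel_measurable lborel"
    unfolding S_fun by measurable
  show ?decomposition
    unfolding S_fun
    by (rule ennreal_combine_energies[OF P11.mean_shifted_V P00.mean_shifted_V P01.mean_shifted_V
        slices[unfolded a11_def a00_def a10_def b11_def b00_def b10_def]
        P11.mean_aniso_slice_finite P00.mean_aniso_slice_finite P01.mean_aniso_slice_finite])
qed

section \<open>Positivity of the interaction energy\<close>

theorem theorem1p1:
  fixes \<mu>0 \<mu>1 :: "(real^2) measure"
  assumes "\<mu>0 \<in> borel_prob_R2" and "\<mu>1 \<in> borel_prob_R2"
    and "compact (topological_support \<mu>0)" and "compact (topological_support \<mu>1)"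
    and "interaction \<mu>0 \<mu>0 < \<infinity>" and "interaction \<mu>1 \<mu>1 < \<infinity>"
  shows "interaction_diff \<mu>1 \<mu>0 \<ge> 0 \<and> (interaction_diff \<mu>1 \<mu>0 = 0 \<longleftrightarrow> \<mu>0 = \<mu>1)"
proof -
  define K where "K = topological_support \<mu>0 \<union> topological_support \<mu>1"
  have K: "compact K" unfolding K_def using assms by (intro compact_Un)
  have \<mu>0: "prob_space \<mu>0" "sets \<mu>0 = sets borel" and \<mu>1: "prob_space \<mu>1" "sets \<mu>1 = sets borel"
    using assms(1,2) by (auto simp: borel_prob_R2_def)
  interpret \<mu>0: prob_space \<mu>0 by fact
  interpret \<mu>1: prob_space \<mu>1 by fact
  have AE0: "AE x in \<mu>0. x \<in> K" and AE1: "AE x in \<mu>1. x \<in> K"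
    using AE_topological_support[OF \<mu>0(2)] AE_topological_support[OF \<mu>1(2)] by (auto simp: K_def)
  obtain b where b: "\<And>x. x \<in> K \<Longrightarrow> norm x \<le> b"
    using compact_imp_bounded[OF K] by (auto simp: bounded_iff)
  \<comment> \<open>at least \<open>1\<close>, so that \<open>ln R\<close> is nonnegative\<close>
  define R where "R = max 1 (2 * b)"
  have R: "1 \<le> R" by (simp add: R_def)
  have close: "norm (x - y) \<le> R" if "x \<in> K" "y \<in> K" for x y
    using norm_triangle_ineq4[of x y] b[OF that(1)] b[OF that(2)] by (simp add: R_def)
  note M0 = \<mu>0 AE0 and M1 = \<mu>1 AE1
  define W where "W \<mu> \<nu> = (\<integral>\<^sup>+z. shifted_V R (fst z - snd z) \<partial>(\<nu> \<Otimes>\<^sub>M \<mu>))" for \<mu> \<nu> :: "(real^2) measure"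
  have I00: "interaction \<mu>0 \<mu>0 = enn2ereal (W \<mu>0 \<mu>0) - ereal (ln R)"
    and I11: "interaction \<mu>1 \<mu>1 = enn2ereal (W \<mu>1 \<mu>1) - ereal (ln R)"
    and I10: "interaction \<mu>1 \<mu>0 = enn2ereal (W \<mu>1 \<mu>0) - ereal (ln R)"
    unfolding W_def
    by (rule interaction_eq_nn_integral[OF M0 M0 R close] interaction_eq_nn_integral[OF M1 M1 R close]
        interaction_eq_nn_integral[OF M1 M0 R close]; assumption)+
  define D where "D = (\<integral>\<^sup>+t. ennreal (scale_energy \<mu>1 \<mu>0 t) * indicator {0<..} t \<partial>lborel)"
  have sum: "W \<mu>1 \<mu>1 + W \<mu>0 \<mu>0 = 2 * W \<mu>1 \<mu>0 + D"
    unfolding W_def D_def by (rule energy_scale_decomposition(2)[OF M0 M1 R]) (rule close)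
  have S: "(\<lambda>t. ennreal (scale_energy \<mu>1 \<mu>0 t) * indicator {0<..} t) \<in> borel_measurable lborel"
    by (rule energy_scale_decomposition(1)[OF M0 M1 R]) (rule close)
  have fin: "W \<mu>0 \<mu>0 < top" "W \<mu>1 \<mu>1 < top"
    using assms(5,6) unfolding I00 I11 by (cases "W \<mu>0 \<mu>0"; cases "W \<mu>1 \<mu>1"; simp)+
  \<comment> \<open>the decomposition forces the mixed energy to be finite\<close>
  have "2 * W \<mu>1 \<mu>0 + D < top" using fin unfolding sum[symmetric] by simp
  then have fin': "W \<mu>1 \<mu>0 < top" "D < top"
    by (auto simp: less_top[symmetric] ennreal_mult_eq_top_iff)
  have real: "\<exists>r\<ge>0. x = ennreal r" if "x < top" for x
    using that by (cases x) auto
  obtain w0 w1 w d where w: "W \<mu>0 \<mu>0 = ennreal w0" "W \<mu>1 \<mu>1 = ennreal w1" "W \<mu>1 \<mu>0 = ennreal w" "D = ennreal d"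
    and nonneg: "0 \<le> w0" "0 \<le> w1" "0 \<le> w" "0 \<le> d"
    using real[OF fin(1)] real[OF fin(2)] real[OF fin'(1)] real[OF fin'(2)] by blast
  have "ennreal (w1 + w0) = ennreal (2 * w + d)"
    using sum nonneg by (simp add: w ennreal_mult)
  then have "w1 + w0 = 2 * w + d" using nonneg by (subst (asm) ennreal_inj) auto
  then have diff: "interaction_diff \<mu>1 \<mu>0 = ereal d"
    unfolding interaction_diff_def I00 I11 I10 w using nonneg by (simp add: enn2ereal_ennreal)
  have "\<mu>0 = \<mu>1" if "d = 0"
  proof -
    have AE: "AE t in lborel. ennreal (scale_energy \<mu>1 \<mu>0 t) * indicator {0<..} t = 0"
      using w(4) that nn_integral_0_iff_AE[OF S] by (simp add: D_def)
    \<comment> \<open>one scale with vanishing energy is enough to recover the measures\<close>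
    have "\<exists>t>0. scale_energy \<mu>1 \<mu>0 t = 0"
    proof (rule ccontr)
      assume *: "\<not> ?thesis"
      have "AE t in lborel. t \<notin> {0<..<1::real}"
        using AE
      proof eventually_elim
        case (elim t)
        have "t \<le> 0"
        proof (rule ccontr)
          assume "\<not> t \<le> 0"
          then have "scale_energy \<mu>1 \<mu>0 t \<le> 0" using elim by (simp add: ennreal_eq_0_iff)
          then show False using * \<open>\<not> t \<le> 0\<close> scale_energy_nonneg[of t \<mu>1 \<mu>0] by force
        qed
        then show ?case by simp
      qed
      then have "{0<..<1::real} \<in> null_sets lborel"
        by (simp only: AE_iff_null_sets sets_lborel borel_open open_greaterThanLessThan)
      then have "emeasure lborel {0<..<1::real} = 0" by (rule null_setsD1)
      then show False by (simp only: emeasure_lborel_Ioo) simp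
    qed
    then obtain t where t: "0 < t" "scale_energy \<mu>1 \<mu>0 t = 0" by blast
    note energy = dipole_energy(1)[OF \<mu>1.finite_measure_axioms \<mu>1(2) \<mu>0.finite_measure_axioms \<mu>0(2) t(1)]
    have "(\<integral>\<omega>. (dipole_transform (2 * t) \<mu>1 \<omega> - dipole_transform (2 * t) \<mu>0 \<omega>)\<^sup>2 \<partial>lborel) = 0"
      using t by (simp add: scale_energy_def)
    then have "AE \<omega> in lborel. dipole_transform (2 * t) \<mu>1 \<omega> = dipole_transform (2 * t) \<mu>0 \<omega>"
      using integral_nonneg_eq_0_iff_AE[OF energy] by simp
    then have "dipole_transform (2 * t) \<mu>0 \<omega> = dipole_transform (2 * t) \<mu>1 \<omega>" for \<omega>
      using dipole_transform_eq_if_AE[OF \<mu>1.finite_measure_axioms \<mu>1(2) \<mu>0.finite_measure_axioms \<mu>0(2), of "2 * t" \<omega>] t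
      by simp
    then show "\<mu>0 = \<mu>1"
      using dipole_transform_injective[OF \<mu>0.finite_measure_axioms \<mu>0(2) AE0 \<mu>1.finite_measure_axioms \<mu>1(2) AE1 K, of "2 * t"] t
      by simp
  qed
  moreover have "d = 0" if "\<mu>0 = \<mu>1"
    using \<open>w1 + w0 = 2 * w + d\<close> w(1-3) nonneg that by (simp add: ennreal_inj)
  ultimately show ?thesis using diff nonneg(4) by auto
qed

end
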